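(* Let $p\ge 5$ and $d\ge 2$ be integers and let $n_1,\dots,n_{d-1}\ge1$ be integers. Consider the depth-$d$ ReLU Bayesian neural network prior on $\boldsymbol{\theta}\in\mathbb{R}^p$ with hidden widths $n_1,\dots,n_{d-1}$ whose effective output variance $$W:=2^{d-1}\|\boldsymbol{x}\|^2\prod_{\ell=1}^d\sigma_\ell^2\prod_{\ell=1}^{d-1}T_\ell,\qquad T_\ell\sim\Gamma(k_\ell/2,1),\quad k_\ell\in\{1,\dots,n_\ell\},\ \ell\in\{1,\dots,d-1\},$$ is given the hyperprior $W\sim\mathrm{BetaPrime}(1,\tfrac p2-2)$ (construction detailed in the context). Then the induced Bayes decision rule $\boldsymbol{\delta}_\pi(\boldsymbol{Y})=\mathbb{E}[\boldsymbol{\theta}\mid\boldsymbol{Y}]$ in the model $\boldsymbol{Y}\mid\boldsymbol{\theta}\sim N_p(\boldsymbol{\theta},I_p)$ under quadratic loss is minimax.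
   Context: Decision problem: observe $\boldsymbol{Y}\mid\boldsymbol{\theta}\sim N_p(\boldsymbol{\theta},I_p)$ with unknown $\boldsymbol{\theta}\in\mathbb{R}^p$; loss $\|\boldsymbol{\theta}-\boldsymbol{\delta}\|^2$; risk $R(\boldsymbol{\theta},\boldsymbol{\delta})=\mathbb{E}_{\boldsymbol{\theta}}[\|\boldsymbol{\theta}-\boldsymbol{\delta}(\boldsymbol{Y})\|^2]$. A rule $\boldsymbol{\delta}_*$ is minimax if $\sup_{\boldsymbol{\theta}}R(\boldsymbol{\theta},\boldsymbol{\delta}_* )=\inf_{\boldsymbol{\delta}}\sup_{\boldsymbol{\theta}}R(\boldsymbol{\theta},\boldsymbol{\delta})$ over all estimators; it is known that the minimax risk equals $p$. Prior: the index $\boldsymbol{k}=(k_1,\dots,k_{d-1})$, $1\le k_\ell\le n_\ell$, has weight $\omega_{\boldsymbol{k}}=2^{-(n_1+\dots+n_{d-1})}\prod_{\ell=1}^{d-1}\binom{n_\ell}{k_\ell}$ (the total mass is finite but not one, since the atom at the zero vector of the network output is discarded; normalization does not affect the Bayes rule). Given $\boldsymbol{k}$, the $T_\ell\sim\Gamma(k_\ell/2,1)$ (shape $k_\ell/2$, rate 1) are independent, and $S=\prod_{\ell=1}^{d-1}T_\ell$. Let $U=2^{d-1}\|\boldsymbol{x}\|^2\prod_{\ell=1}^d\sigma_\ell^2$, now treated as a random scale; given $(U,S,\boldsymbol{k})$, $\boldsymbol{\theta}\sim N_p(\boldsymbol{0}_p,US\,I_p)$. The hyperprior is placed on $U$ so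 that, conditionally on $(S,\boldsymbol{k})$, $W=US$ has the $\mathrm{BetaPrime}(1,b)$ density $h(w)=b(1+w)^{-(b+1)}$, $w>0$, with $b=\tfrac p2-2$; that is, $U$ given $S=s,\boldsymbol{k}$ has density $s\,h(us)$, $u>0$. $\pi$ denotes the resulting marginal prior of $\boldsymbol{\theta}$, and $\boldsymbol{\delta}_\pi$ is the posterior mean under $\pi$. *)

theory Defs
  imports "HOL-Probability.Probability"
begin

section \<open>The decision problem\<close>

text \<open>Only variances \<open>v > 0\<close> are meaningful; for other \<open>v\<close> (a null event below) the function is
  still a subprobability density, so that \<open>normal_vec\<close> is a kernel on all of \<^typ>\<open>real\<close>.\<close>

definition normal_vec_density :: "real ^ 'p \<Rightarrow> real \<Rightarrow> real ^ 'p \<Rightarrow> real" where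
  "normal_vec_density m v y = (\<Prod>i\<in>UNIV. normal_density (m $ i) (sqrt v) (y $ i))"

definition normal_vec :: "real ^ 'p \<Rightarrow> real \<Rightarrow> (real ^ 'p) measure" where
  "normal_vec m v = density lborel (\<lambda>y. ennreal (normal_vec_density m v y))"

text \<open>Risks take values in \<^typ>\<open>ennreal\<close>, since an arbitrary estimator may have infinite risk.\<close>

definition risk :: "real ^ 'p \<Rightarrow> (real ^ 'p \<Rightarrow> real ^ 'p) \<Rightarrow> ennreal" where
  "risk \<theta> \<delta> = (\<integral>\<^sup>+ y. ennreal ((norm (\<theta> - \<delta> y))\<^sup>2) \<partial>normal_vec \<theta> 1)"

definition minimax :: "(real ^ 'p \<Rightarrow> real ^ 'p) \<Rightarrow> bool" where
  "minimax \<delta> \<longleftrightarrow> \<delta> \<in> borel_measurable borel \<and>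
     (SUP \<theta>. risk \<theta> \<delta>) =
     (INF \<delta>' \<in> (borel_measurable borel :: (real ^ 'p \<Rightarrow> real ^ 'p) set). SUP \<theta>. risk \<theta> \<delta>')"

text \<open>The posterior is given by Bayes' formula, hence for every observation \<open>y\<close>, not just almost
  surely. It is unchanged when the prior is multiplied by a positive constant. Defining
  \<open>E[\<theta> | Y]\<close> as a conditional expectation under the joint law would fail in general, as
  \<open>\<theta>\<close> need not be integrable under the prior.\<close>

definition posterior :: "(real ^ 'p) measure \<Rightarrow> real ^ 'p \<Rightarrow> (real ^ 'p) measure" where
  "posterior \<pi> y = density \<pi> (\<lambda>\<theta>. ennreal (normal_vec_density \<theta> 1 y) /
     (\<integral>\<^sup>+ \<theta>'. ennreal (normal_vec_density \<theta>' 1 y) \<partial>\<pi>))"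

definition posterior_mean :: "(real ^ 'p) measure \<Rightarrow> real ^ 'p \<Rightarrow> real ^ 'p" where
  "posterior_mean \<pi> y = (\<integral>\<theta>. \<theta> \<partial>posterior \<pi> y)"

section \<open>The ReLU network prior\<close>

text \<open>The weight of \<open>k\<close> is the probability that exactly \<open>k l\<close> of the \<open>n l\<close> units are active in each
  hidden layer \<open>l\<close>. Indices with some \<open>k l = 0\<close> are left out, so the total mass is below one.\<close>

definition active_units :: "nat \<Rightarrow> (nat \<Rightarrow> nat) \<Rightarrow> (nat \<Rightarrow> nat) measure" where
  "active_units d n = point_measure (\<Pi>\<^sub>E l\<in>{1..d-1}. {1..n l})
     (\<lambda>k. ennreal ((\<Prod>l\<in>{1..d-1}. real (n l choose k l)) / 2 ^ (\<Sum>l\<in>{1..d-1}. n l)))"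

text \<open>Shape \<open>a\<close>, rate \<open>1\<close>.\<close>

definition gamma_law :: "real \<Rightarrow> real measure" where
  "gamma_law a = density lborel
     (\<lambda>t. ennreal (if t > 0 then t powr (a - 1) * exp (- t) / Gamma a else 0))"

text \<open>The density of \<open>BetaPrime(1, b)\<close>.\<close>

definition beta_prime_1_density :: "real \<Rightarrow> real \<Rightarrow> real" where
  "beta_prime_1_density b w = (if w > 0 then b * (1 + w) powr (- (b + 1)) else 0)"

text \<open>The law of the scale \<open>U\<close> given \<open>S = s\<close>, chosen such that \<open>U * s\<close> is \<open>BetaPrime(1, b)\<close>
  distributed if \<open>s > 0\<close>. It is the null measure for the other \<open>s\<close>, which have probability zero.\<close>

definition scale_law :: "real \<Rightarrow> real \<Rightarrow> real measure" where
  "scale_law b s = density lborel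
     (\<lambda>u. ennreal (if u > 0 then s * beta_prime_1_density b (u * s) else 0))"

text \<open>The scale \<open>u\<close> stands for the product of \<open>2 ^ (d - 1)\<close>, the squared norm of the input and the
  weight variances of all \<open>d\<close> layers.\<close>

definition relu_prior :: "nat \<Rightarrow> (nat \<Rightarrow> nat) \<Rightarrow> (real ^ 'p) measure" where
  "relu_prior d n = do {
     k \<leftarrow> active_units d n;
     T \<leftarrow> (\<Pi>\<^sub>M l\<in>{1..d-1}. gamma_law (real (k l) / 2));
     let s = (\<Prod>l\<in>{1..d-1}. T l);
     u \<leftarrow> scale_law (real CARD('p) / 2 - 2) s;
     normal_vec 0 (u * s)
   }"

end

theory Submission
  imports Defs
begin

text \<open>Since \<open>U\<close> is scaled such that \<open>W = U S\<close> has the same law for all \<open>S\<close> and \<open>k\<close>, the prior is a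
  constant multiple of the mixture of \<open>N(0, w I)\<close> over \<open>w ~ BetaPrime(1, p/2 - 2)\<close>. With
  \<open>L = 1 / (1 + w)\<close>, the posterior mean is \<open>(1 - \<psi>(|y|\<^sup>2)) y\<close>, where \<open>\<psi>(r)\<close> is the quotient of the
  integrals of \<open>L^p exp (-L r / 2)\<close> and \<open>L^(p - 1) exp (-L r / 2)\<close> over \<open>w > 0\<close>. Integration by parts
  in \<open>w\<close> relates consecutive integrals of this kind and shows that Stein's unbiased risk estimate is
  at most \<open>p\<close> everywhere. Conversely no estimator has maximal risk below \<open>p\<close>, as the Bayes risks of the
  priors \<open>N(0, v I)\<close> tend to \<open>p\<close> for large \<open>v\<close>.\<close>

section \<open>Gaussian integrals\<close>

text \<open>Why \<open>b = p/2 - 2\<close>: the hyperprior contributes the power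
  \<open>b + 1\<close> of L and the marginal law \<open>N(0, 1 + w)\<close> of the observation
  contributes \<open>p/2\<close>, so the total is the integer \<open>p - 1\<close>, while
  \<open>p \<ge> 5\<close> keeps b positive. For general b the integration by parts would give
  \<open>r * \<psi> r \<le> 2 * b + p\<close>, and this bound is within Baranchik's limit
  \<open>2 * (p - 2)\<close> exactly if \<open>b \<le> p/2 - 2\<close>; the prior sits at the end of
  that range. There all terms of Stein's estimate cancel except those with the boundary term of the
  integration by parts, and these have the right sign because \<open>\<psi> \<le> 1\<close>. The
  obstacle on the Bayesian side is that the prior need not have a mean (for \<open>p = 5\<close> it
  has none), so nothing can be taken from its moments. The posterior mean is computed on the joint
  law of w and \<theta> instead, where the moments of \<theta> given w and y are bounded uniformly
  in w.\<close>

lemma nn_integral_lborel_vec_prod: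
  fixes f :: "'p::finite \<Rightarrow> real \<Rightarrow> ennreal"
  assumes [measurable]: "\<And>i. f i \<in> borel_measurable borel"
  shows "(\<integral>\<^sup>+x. (\<Prod>i\<in>UNIV. f i (x $ i)) \<partial>(lborel :: (real^'p) measure)) = (\<Prod>i\<in>UNIV. \<integral>\<^sup>+t. f i t \<partial>lborel)"
proof -
  \<comment> \<open>Inverts \<open>i \<mapsto> axis i 1\<close>: the product formula for Lebesgue
    measure is indexed by basis vectors, the family \<open>f\<close> by coordinates.\<close>
  define g where "g b = f (SOME i. b = axis i (1::real))" for b :: "real^'p"
  have g: "g (axis i 1) = f i" for i
    by (simp add: g_def axis_eq_axis)
  have B: "(Basis :: (real^'p) set) = range (\<lambda>i. axis i 1)"
    by (auto simp: Basis_vec_def)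
  have inj: "inj (\<lambda>i::'p. axis i (1::real))"
    by (simp add: inj_def axis_eq_axis)
  have "(\<integral>\<^sup>+x. (\<Prod>b\<in>Basis. g b (x \<bullet> b)) \<partial>(lborel :: (real^'p) measure)) = (\<Prod>b\<in>(Basis :: (real^'p) set). \<integral>\<^sup>+t. g b t \<partial>lborel)"
    by (rule nn_integral_lborel_prod) (auto simp: g_def)
  then show ?thesis
    by (simp add: B prod.reindex[OF inj] g cart_eq_inner_axis)
qed

lemma normal_vec_density_nonneg [simp]: "0 \<le> normal_vec_density m v y"
  by (simp add: normal_vec_density_def prod_nonneg)

lemma borel_measurable_normal_vec_density [measurable]:
  assumes [measurable]: "f \<in> borel_measurable M" "g \<in> borel_measurable M" "h \<in> borel_measurable M"
  shows "(\<lambda>x. normal_vec_density (f x :: real ^ 'p) (g x) (h x)) \<in> borel_measurable M"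
proof -
  have nth: "(\<lambda>x::real^'p. x $ i) \<in> borel_measurable borel" for i
    by (intro borel_measurable_continuous_onI continuous_intros)
  note [measurable] = measurable_compose[OF assms(1) nth] measurable_compose[OF assms(3) nth]
    measurable_compose[OF assms(2) borel_measurable_sqrt]
  show ?thesis
    unfolding normal_vec_density_def normal_density_def by measurable
qed

text \<open>Expanding \<open>(t - a)^2\<close> about m leaves the central moments of order 2, 1 and
  0, with values v, 0 and 1.\<close>

lemma nn_integral_normal_density_second_moment:
  assumes "0 < v"
  shows "(\<integral>\<^sup>+t. ennreal ((t - a)\<^sup>2) * ennreal (normal_density m (sqrt v) t) \<partial>lborel) = ennreal (v + (m - a)\<^sup>2)"
proof -
  have s: "0 < sqrt v" using assms by simp
  have "has_bochner_integral lborel (\<lambda>t. normal_density m (sqrt v) t * (t - m)\<^sup>2 +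
      (normal_density m (sqrt v) t * (t - m) * (2 * (m - a)) + normal_density m (sqrt v) t * (m - a)\<^sup>2))
      (v + (0 * (2 * (m - a)) + 1 * (m - a)\<^sup>2))"
    using normal_moment_even[OF s, of m 1] normal_moment_odd[OF s, of m 0] normal_moment_even[OF s, of m 0] assms
    by (intro has_bochner_integral_add has_bochner_integral_mult_left)
       (auto simp: fact_numeral)
  moreover have "normal_density m (sqrt v) t * (t - m)\<^sup>2 +
      (normal_density m (sqrt v) t * (t - m) * (2 * (m - a)) + normal_density m (sqrt v) t * (m - a)\<^sup>2)
      = (t - a)\<^sup>2 * normal_density m (sqrt v) t" for t
    by (simp add: power2_eq_square algebra_simps)
  ultimately have "has_bochner_integral lborel (\<lambda>t. (t - a)\<^sup>2 * normal_density m (sqrt v) t) (v + (m - a)\<^sup>2)"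
    by simp
  then have "(\<integral>\<^sup>+t. ennreal ((t - a)\<^sup>2 * normal_density m (sqrt v) t) \<partial>lborel) = ennreal (v + (m - a)\<^sup>2)"
    by (subst nn_integral_eq_integral) (auto simp: has_bochner_integral_iff)
  then show ?thesis by (simp add: ennreal_mult)
qed

lemma nn_integral_normal_density:
  assumes "0 < v"
  shows "(\<integral>\<^sup>+t. ennreal (normal_density m (sqrt v) t) \<partial>lborel) = 1"
  using assms by (subst nn_integral_eq_integral) auto

lemma nn_integral_normal_vec_density:
  assumes "0 < v"
  shows "(\<integral>\<^sup>+y. ennreal (normal_vec_density (m :: real^'p) v y) \<partial>lborel) = 1"
proof -
  have "(\<integral>\<^sup>+y. ennreal (normal_vec_density m v y) \<partial>lborel) =
      (\<integral>\<^sup>+y. (\<Prod>i\<in>UNIV. ennreal (normal_density (m $ i) (sqrt v) (y $ i))) \<partial>lborel)"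
    by (simp add: normal_vec_density_def prod_ennreal)
  also have "\<dots> = (\<Prod>i\<in>(UNIV::'p set). \<integral>\<^sup>+t. ennreal (normal_density (m $ i) (sqrt v) t) \<partial>lborel)"
    by (rule nn_integral_lborel_vec_prod) simp
  finally show ?thesis using assms by (simp add: nn_integral_normal_density)
qed

lemma norm_vec_power2: "(norm (x :: real^'p))\<^sup>2 = (\<Sum>i\<in>UNIV. (x $ i)\<^sup>2)"
  unfolding power2_norm_eq_inner by (simp add: inner_vec_def power2_eq_square)

lemma nn_integral_normal_vec_density_second_moment:
  assumes "0 < v"
  shows "(\<integral>\<^sup>+y. ennreal ((norm (y - a))\<^sup>2) * ennreal (normal_vec_density (m :: real^'p) v y) \<partial>lborel)
    = ennreal (real CARD('p) * v + (norm (m - a))\<^sup>2)"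
proof -
  have *: "(\<integral>\<^sup>+y. ennreal ((y $ i - a $ i)\<^sup>2) * ennreal (normal_vec_density m v y) \<partial>lborel)
      = ennreal (v + (m $ i - a $ i)\<^sup>2)" for i
  proof -
    \<comment> \<open>The square is carried by the factor of coordinate i only, so the integrand
      remains a product over coordinates.\<close>
    define f where "f j t = (if j = i then ennreal ((t - a $ i)\<^sup>2) else 1) * ennreal (normal_density (m $ j) (sqrt v) t)" for j t
    have fm: "f j \<in> borel_measurable borel" for j
      by (cases "j = i") (simp_all add: f_def[abs_def])
    have "ennreal ((y $ i - a $ i)\<^sup>2) * ennreal (normal_vec_density m v y) = (\<Prod>j\<in>UNIV. f j (y $ j))" for y
      by (simp add: f_def prod.distrib normal_vec_density_def prod_ennreal)
    then have "(\<integral>\<^sup>+y. ennreal ((y $ i - a $ i)\<^sup>2) * ennreal (normal_vec_density m v y) \<partial>lborel)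
        = (\<Prod>j\<in>UNIV. \<integral>\<^sup>+t. f j t \<partial>lborel)"
      by (subst nn_integral_lborel_vec_prod[OF fm, symmetric]) simp
    also have "\<dots> = (\<Prod>j\<in>UNIV. if j = i then ennreal (v + (m $ i - a $ i)\<^sup>2) else 1)"
      using assms by (intro prod.cong) (auto simp: f_def nn_integral_normal_density nn_integral_normal_density_second_moment)
    finally show ?thesis by simp
  qed
  have "(\<integral>\<^sup>+y. ennreal ((norm (y - a))\<^sup>2) * ennreal (normal_vec_density m v y) \<partial>lborel)
      = (\<integral>\<^sup>+y. (\<Sum>i\<in>UNIV. ennreal ((y $ i - a $ i)\<^sup>2) * ennreal (normal_vec_density m v y)) \<partial>lborel)"
    by (simp add: norm_vec_power2 sum_distrib_right flip: sum_ennreal)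
  also have "\<dots> = (\<Sum>i\<in>UNIV. ennreal (v + (m $ i - a $ i)\<^sup>2))"
    by (subst nn_integral_sum) (auto simp: *)
  also have "\<dots> = ennreal (\<Sum>i\<in>UNIV. v + (m $ i - a $ i)\<^sup>2)"
    using assms by (intro sum_ennreal) auto
  also have "(\<Sum>i\<in>UNIV. v + (m $ i - a $ i)\<^sup>2) = real CARD('p) * v + (norm (m - a))\<^sup>2"
    by (simp add: norm_vec_power2 sum.distrib)
  finally show ?thesis .
qed

text \<open>Conjugacy: both sides are the joint density of a mean \<open>t ~ N(0, v)\<close> and an
  observation \<open>y ~ N(t, 1)\<close>, factored once as prior times likelihood and once as
  marginal times posterior. Fact \<open>c\<close> compares the constants, fact \<open>e\<close>
  completes the square.\<close>

lemma normal_density_mult: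
  assumes "0 < v"
  shows "normal_density 0 (sqrt v) t * normal_density t 1 y =
    normal_density 0 (sqrt (1 + v)) y * normal_density (v / (1 + v) * y) (sqrt (v / (1 + v))) t"
proof -
  have c: "1 / sqrt (2 * pi * v) * (1 / sqrt (2 * pi)) = 1 / sqrt (2 * pi * (1 + v)) * (1 / sqrt (2 * pi * (v / (1 + v))))"
    using assms by (simp add: field_simps flip: real_sqrt_mult)
  have e: "- (t\<^sup>2 / (2 * v)) + - ((y - t)\<^sup>2 / 2) = - (y\<^sup>2 / (2 * (1 + v))) + - ((t - v / (1 + v) * y)\<^sup>2 / (2 * (v / (1 + v))))"
    using assms by (simp add: divide_simps add_eq_0_iff) (simp add: power2_eq_square algebra_simps)
  have "normal_density 0 (sqrt v) t * normal_density t 1 y =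
      (1 / sqrt (2 * pi * v) * (1 / sqrt (2 * pi))) * exp (- (t\<^sup>2 / (2 * v)) + - ((y - t)\<^sup>2 / 2))"
    using assms by (simp only: normal_density_def exp_add) simp
  also have "\<dots> = normal_density 0 (sqrt (1 + v)) y * normal_density (v / (1 + v) * y) (sqrt (v / (1 + v))) t"
    unfolding c e using assms by (simp only: normal_density_def exp_add) simp
  finally show ?thesis .
qed

lemma normal_vec_density_mult:
  assumes "0 < v"
  shows "normal_vec_density 0 v t * normal_vec_density t 1 y =
    normal_vec_density 0 (1 + v) y * normal_vec_density ((v / (1 + v)) *\<^sub>R y) (v / (1 + v)) t"
  unfolding normal_vec_density_def prod.distrib[symmetric]
  using normal_density_mult[OF assms] by (intro prod.cong) auto

lemma normal_vec_density_eq: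
  assumes "0 < v"
  shows "normal_vec_density (m :: real^'p) v y = exp (- ((norm (y - m))\<^sup>2 / (2 * v))) / sqrt (2 * pi * v) ^ CARD('p)"
  using assms unfolding normal_vec_density_def normal_density_def
  by (simp add: prod_dividef flip: exp_sum) (simp add: norm_vec_power2 sum_divide_distrib sum_negf)

lemma nn_integral_density_normal_vec:
  assumes [measurable]: "f \<in> borel_measurable borel"
  shows "(\<integral>\<^sup>+y. f y \<partial>normal_vec m v) = (\<integral>\<^sup>+y. f y * ennreal (normal_vec_density m v y) \<partial>lborel)"
  unfolding normal_vec_def by (subst nn_integral_density) (auto simp: mult.commute)

section \<open>The lower bound\<close>

text \<open>A supremum dominates every average. Under the prior \<open>N(0, v I)\<close> the
  posterior of \<theta> has covariance \<open>v / (1 + v) I\<close>, so every action has posterior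
  expected loss at least \<open>p * v / (1 + v)\<close>, whatever is observed.\<close>

lemma minimax_risk_ge:
  fixes \<delta> :: "real^'p \<Rightarrow> real^'p"
  assumes [measurable]: "\<delta> \<in> borel_measurable borel"
  shows "ennreal (real CARD('p)) \<le> (SUP \<theta>. risk \<theta> \<delta>)"
proof -
  have *: "ennreal (real CARD('p) * (v / (1 + v))) \<le> (SUP \<theta>. risk \<theta> \<delta>)" if v: "0 < v" for v
  proof -
    have w: "0 < v / (1 + v)" using v by simp
    have "ennreal (real CARD('p) * (v / (1 + v))) =
        (\<integral>\<^sup>+y. ennreal (normal_vec_density 0 (1 + v) y) * ennreal (real CARD('p) * (v / (1 + v))) \<partial>(lborel :: (real^'p) measure))"
      using v by (subst nn_integral_multc) (auto simp: nn_integral_normal_vec_density)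
    \<comment> \<open>The posterior expected loss is the trace of the posterior covariance plus a
      squared distance, which is dropped.\<close>
    also have "\<dots> \<le> (\<integral>\<^sup>+y. ennreal (normal_vec_density 0 (1 + v) y) *
        (\<integral>\<^sup>+t. ennreal ((norm (t - \<delta> y))\<^sup>2) * ennreal (normal_vec_density ((v / (1 + v)) *\<^sub>R y) (v / (1 + v)) t) \<partial>lborel) \<partial>lborel)"
      by (intro nn_integral_mono mult_left_mono)
         (auto simp: nn_integral_normal_vec_density_second_moment[OF w] intro!: ennreal_leI)
    also have "\<dots> = (\<integral>\<^sup>+y. \<integral>\<^sup>+t. ennreal (normal_vec_density 0 v t) * (ennreal ((norm (t - \<delta> y))\<^sup>2) * ennreal (normal_vec_density t 1 y)) \<partial>lborel \<partial>lborel)"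
    proof (intro nn_integral_cong)
      fix y :: "real^'p"
      have "ennreal (normal_vec_density 0 (1 + v) y) *
          (ennreal ((norm (t - \<delta> y))\<^sup>2) * ennreal (normal_vec_density ((v / (1 + v)) *\<^sub>R y) (v / (1 + v)) t)) =
          ennreal (normal_vec_density 0 v t) * (ennreal ((norm (t - \<delta> y))\<^sup>2) * ennreal (normal_vec_density t 1 y))" for t
        using normal_vec_density_mult[OF v, of t y] by (simp add: mult_ac flip: ennreal_mult)
      then show "ennreal (normal_vec_density 0 (1 + v) y) *
          (\<integral>\<^sup>+t. ennreal ((norm (t - \<delta> y))\<^sup>2) * ennreal (normal_vec_density ((v / (1 + v)) *\<^sub>R y) (v / (1 + v)) t) \<partial>lborel)
          = (\<integral>\<^sup>+t. ennreal (normal_vec_density 0 v t) * (ennreal ((norm (t - \<delta> y))\<^sup>2) * ennreal (normal_vec_density t 1 y)) \<partial>lborel)"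
        by (subst nn_integral_cmult[symmetric]) auto
    qed
    \<comment> \<open>Tonelli: the integrand is nonnegative, so the exchange is allowed even if the
      risk is infinite. Averaging over y first then produces the risk at t.\<close>
    also have "\<dots> = (\<integral>\<^sup>+t. \<integral>\<^sup>+y. ennreal (normal_vec_density 0 v t) * (ennreal ((norm (t - \<delta> y))\<^sup>2) * ennreal (normal_vec_density t 1 y)) \<partial>lborel \<partial>lborel)"
      by (rule lborel_pair.Fubini') measurable
    also have "\<dots> = (\<integral>\<^sup>+t. ennreal (normal_vec_density 0 v t) * risk t \<delta> \<partial>lborel)"
      unfolding risk_def by (simp add: nn_integral_density_normal_vec nn_integral_cmult)
    also have "\<dots> \<le> (\<integral>\<^sup>+t. ennreal (normal_vec_density 0 v t) * (SUP \<theta>. risk \<theta> \<delta>) \<partial>(lborel :: (real^'p) measure))"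
      by (intro nn_integral_mono mult_left_mono) (auto intro: SUP_upper)
    also have "\<dots> = (SUP \<theta>. risk \<theta> \<delta>)"
      using v by (subst nn_integral_multc) (auto simp: nn_integral_normal_vec_density)
    finally show ?thesis .
  qed
  \<comment> \<open>Priors with \<open>v = k + 1\<close>.\<close>
  have "(\<lambda>k. real CARD('p) * (real (Suc k) / (1 + real (Suc k)))) \<longlonglongrightarrow> real CARD('p) * 1"
    by (intro tendsto_mult tendsto_const) (use LIMSEQ_Suc[OF LIMSEQ_n_over_Suc_n] in simp)
  then have "(\<lambda>k. ennreal (real CARD('p) * (real (Suc k) / (1 + real (Suc k))))) \<longlonglongrightarrow> ennreal (real CARD('p))"
    by (intro tendsto_ennrealI) simp
  then show ?thesis
    by (rule LIMSEQ_le_const2) (intro exI allI impI *, simp)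
qed

section \<open>Stein's identity and the risk of shrinkage rules\<close>

lemma lborel_translate:
  fixes f :: "'a::euclidean_space \<Rightarrow> real"
  assumes "integrable lborel f"
  shows "integrable lborel (\<lambda>x. f (x + c))" and "(\<integral>x. f (x + c) \<partial>lborel) = (\<integral>x. f x \<partial>lborel)"
proof -
  have [measurable]: "f \<in> borel_measurable borel" using assms by auto
  have "integrable (distr lborel borel ((+) c)) f" "(\<integral>x. f x \<partial>distr lborel borel ((+) c)) = (\<integral>x. f x \<partial>lborel)"
    using assms by (simp_all add: lborel_distr_plus)
  then show "integrable lborel (\<lambda>x. f (x + c))" and "(\<integral>x. f (x + c) \<partial>lborel) = (\<integral>x. f x \<partial>lborel)"
    by (simp_all add: integrable_distr_eq integral_distr add.commute)
qed

text \<open>Averaging \<open>F (y + e) - F y\<close> over \<open>y\<close> gives zero by translation invariance, and the difference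
  is the integral of \<open>D\<close> along the segment, so no splitting into coordinates is needed.\<close>

lemma integral_directional_derivative_eq_0:
  fixes F D :: "'a::euclidean_space \<Rightarrow> real"
  assumes der: "\<And>y. ((\<lambda>t. F (y + t *\<^sub>R e)) has_real_derivative D y) (at 0)"
    and cont: "continuous_on UNIV D"
    and F: "integrable lborel F" and D: "integrable lborel D"
  shows "(\<integral>y. D y \<partial>lborel) = 0"
proof -
  have [measurable]: "D \<in> borel_measurable borel" using D by auto
  \<comment> \<open>A derivative at 0 from every base point is a derivative at every t along the
    line through y.\<close>
  have der': "((\<lambda>t. F (y + t *\<^sub>R e)) has_real_derivative D (y + t *\<^sub>R e)) (at t)" for y t
    using DERIV_shift[of "\<lambda>u. F (y + u *\<^sub>R e)" "D (y + t *\<^sub>R e)" 0 t] der[of "y + t *\<^sub>R e"]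
    by (simp add: scaleR_left_distrib add_ac)
  define f where "f t y = indicator {0..1} t * D (y + t *\<^sub>R e)" for t :: real and y
  have fm: "case_prod f \<in> borel_measurable (lborel \<Otimes>\<^sub>M lborel)"
    unfolding f_def by measurable
  have absD: "integrable lborel (\<lambda>y. \<bar>D y\<bar>)" using D by simp
  have int: "integrable (lborel \<Otimes>\<^sub>M lborel) (case_prod f)"
  proof (rule lborel_pair.Fubini_integrable[OF fm])
    \<comment> \<open>By translation invariance all slices with t in the unit interval have the same
      absolute integral as \<open>D\<close>, so Fubini applies.\<close>
    have "(\<integral>y. norm (f t y) \<partial>lborel) = indicator {0..1} t * (\<integral>y. \<bar>D y\<bar> \<partial>lborel)" for t
      using lborel_translate(2)[OF absD, of "t *\<^sub>R e"] by (simp add: f_def abs_mult)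
    then show "integrable lborel (\<lambda>t. \<integral>y. norm (case_prod f (t, y)) \<partial>lborel)"
      by (simp add: integrable_mult_left)
    show "AE t in lborel. integrable lborel (\<lambda>y. case_prod f (t, y))"
      using lborel_translate(1)[OF D] by (simp add: f_def)
  qed
  have "(\<integral>t. f t y \<partial>lborel) = F (y + e) - F y" for y
  proof -
    have "continuous_on {0..1} (\<lambda>t::real. D (y + t *\<^sub>R e))"
      by (rule continuous_on_compose2[OF cont]) (auto intro!: continuous_intros)
    then have "(\<integral>t. indicator {0..1} t *\<^sub>R D (y + t *\<^sub>R e) \<partial>lborel) = F (y + 1 *\<^sub>R e) - F (y + 0 *\<^sub>R e)"
      using der' by (intro integral_FTC_atLeastAtMost)
        (auto intro: has_vector_derivative_at_within simp: has_real_derivative_iff_has_vector_derivative)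
    then show ?thesis by (simp add: f_def)
  qed
  then have "(\<integral>y. \<integral>t. f t y \<partial>lborel \<partial>lborel) = (\<integral>y. F (y + e) - F y \<partial>lborel)" by simp
  also have "\<dots> = 0"
    using lborel_translate[OF F, of e] F by simp
  finally have "0 = (\<integral>t. \<integral>y. f t y \<partial>lborel \<partial>lborel)"
    using lborel_pair.Fubini_integral[OF int] by simp
  \<comment> \<open>With y integrated first, each slice contributes the integral of
    \<open>D\<close>, and the unit interval has length one.\<close>
  also have "\<dots> = (\<integral>t. indicator {0..1} t * (\<integral>y. D y \<partial>lborel) \<partial>(lborel :: real measure))"
    using lborel_translate(2)[OF D] by (simp add: f_def)
  finally show ?thesis by simp
qed

section \<open>Normal moments as Bochner integrals\<close>

lemma integrable_normal_vec_density:
  fixes \<theta> :: "real^'p"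
  assumes "0 < v"
  shows "integrable lborel (normal_vec_density \<theta> v)" "(\<integral>y. normal_vec_density \<theta> v y \<partial>lborel) = 1"
  using nn_integral_normal_vec_density[OF assms, of \<theta>] nn_integral_eq_integrable[of "normal_vec_density \<theta> v" lborel 1]
  by auto

lemma integrable_normal_vec_density_second_moment:
  fixes \<theta> :: "real^'p"
  assumes "0 < v"
  shows "integrable lborel (\<lambda>y. (norm (y - a))\<^sup>2 * normal_vec_density \<theta> v y)"
    "(\<integral>y. (norm (y - a))\<^sup>2 * normal_vec_density \<theta> v y \<partial>lborel) = real CARD('p) * v + (norm (\<theta> - a))\<^sup>2"
  using nn_integral_normal_vec_density_second_moment[OF assms, of a \<theta>] assms
    nn_integral_eq_integrable[of "\<lambda>y. (norm (y - a))\<^sup>2 * normal_vec_density \<theta> v y" lborel "real CARD('p) * v + (norm (\<theta> - a))\<^sup>2"]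
  by (auto simp flip: ennreal_mult)

text \<open>The last hypothesis says that Stein's unbiased estimate of the risk is at most \<open>p\<close>. It follows
  from Baranchik's conditions on \<open>r \<psi>(r)\<close>.\<close>

lemma risk_shrinkage_le:
  fixes \<psi> \<psi>' :: "real \<Rightarrow> real" and \<theta> :: "real^'p"
  assumes der: "\<And>r. (\<psi> has_real_derivative \<psi>' r) (at r)"
    and cont: "continuous_on UNIV \<psi>'"
    and A: "\<And>r. 0 \<le> r \<Longrightarrow> \<bar>\<psi> r\<bar> \<le> A" and B: "\<And>r. 0 \<le> r \<Longrightarrow> \<bar>\<psi>' r\<bar> \<le> B"
    and le: "\<And>r. 0 \<le> r \<Longrightarrow> r * (\<psi> r)\<^sup>2 \<le> 2 * real CARD('p) * \<psi> r + 4 * r * \<psi>' r"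
  shows "risk \<theta> (\<lambda>y. y - \<psi> ((norm y)\<^sup>2) *\<^sub>R y) \<le> ennreal (real CARD('p))"
proof -
  let ?N = "normal_vec_density \<theta> 1"
  have A0: "0 \<le> A" using A[of 0] by linarith
  have B0: "0 \<le> B" using B[of 0] by linarith
  have cont\<psi>: "continuous_on S \<psi>" for S
    using der by (intro continuous_at_imp_continuous_on ballI DERIV_isCont)
  have N: "?N y = exp (- ((y - \<theta>) \<bullet> (y - \<theta>) / 2)) / sqrt (2 * pi) ^ CARD('p)" for y
    by (simp add: normal_vec_density_eq power2_norm_eq_inner)
  have contN: "continuous_on UNIV ?N"
    unfolding N[abs_def] by (intro continuous_intros) auto
  have cont1: "continuous_on UNIV (\<lambda>y::real^'p. \<psi> (y \<bullet> y))"
    by (rule continuous_on_compose2[OF cont\<psi>]) (auto intro!: continuous_intros)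
  have cont2: "continuous_on UNIV (\<lambda>y::real^'p. \<psi>' (y \<bullet> y))"
    by (rule continuous_on_compose2[OF cont]) (auto intro!: continuous_intros)
  \<comment> \<open>For b in \<open>Basis\<close>, \<open>F b\<close> is the b-component of the
    shrinkage term times the normal density, and \<open>D b\<close> is its derivative in direction
    b; the last summand of \<open>D b\<close> comes from the density. Inner products replace norms
    because they are polynomials along a line.\<close>
  define F where "F b y = \<psi> (y \<bullet> y) * (y \<bullet> b) * ?N y" for b y
  define D where "D b y = (2 * \<psi>' (y \<bullet> y) * (y \<bullet> b)\<^sup>2 + \<psi> (y \<bullet> y) * (b \<bullet> b) - \<psi> (y \<bullet> y) * (y \<bullet> b) * ((y - \<theta>) \<bullet> b)) * ?N y" for b y
  have contF: "continuous_on UNIV (F b)" and contD: "continuous_on UNIV (D b)" for b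
    unfolding F_def[abs_def] D_def[abs_def] by (intro continuous_intros contN cont1 cont2)+
  have derF: "((\<lambda>t. F b (y + t *\<^sub>R b)) has_real_derivative D b y) (at 0)" for b y
  proof -
    have 1: "(y + t *\<^sub>R b) \<bullet> (y + t *\<^sub>R b) = y \<bullet> y + 2 * t * (y \<bullet> b) + t\<^sup>2 * (b \<bullet> b)" for t
      by (simp add: inner_simps power2_eq_square inner_commute algebra_simps)
    have 2: "(y + t *\<^sub>R b - \<theta>) \<bullet> (y + t *\<^sub>R b - \<theta>) = (y - \<theta>) \<bullet> (y - \<theta>) + 2 * t * ((y - \<theta>) \<bullet> b) + t\<^sup>2 * (b \<bullet> b)" for t
      by (simp add: inner_simps power2_eq_square inner_commute algebra_simps)
    have 3: "(y + t *\<^sub>R b) \<bullet> b = y \<bullet> b + t * (b \<bullet> b)" for t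
      by (simp add: inner_simps)
    have 4: "((\<lambda>t. y \<bullet> y + 2 * t * (y \<bullet> b) + t\<^sup>2 * (b \<bullet> b)) has_real_derivative 2 * (y \<bullet> b)) (at 0)"
      by (auto intro!: derivative_eq_intros)
    have 5: "((\<lambda>t. \<psi> (y \<bullet> y + 2 * t * (y \<bullet> b) + t\<^sup>2 * (b \<bullet> b))) has_real_derivative \<psi>' (y \<bullet> y) * (2 * (y \<bullet> b))) (at 0)"
      using DERIV_chain2[OF _ 4, of \<psi> "\<psi>' (y \<bullet> y)"] der[of "y \<bullet> y"] by simp
    show ?thesis
      unfolding F_def N 1 2 3 D_def
      by (rule derivative_eq_intros 5 refl | simp)+ (simp add: field_simps power2_eq_square)
  qed
  \<comment> \<open>All majorants are expressed by the distance to \<theta>, the mean of the normal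
    density, so that \<open>intb\<close> covers them.\<close>
  define c where "c = norm \<theta>"
  define x where "x y = norm (y - \<theta>)" for y
  have ny: "norm y \<le> x y + c" for y
    using norm_triangle_ineq[of "y - \<theta>" \<theta>] by (simp add: x_def c_def)
  have x0: "0 \<le> x y" for y by (simp add: x_def)
  have c0: "0 \<le> c" by (simp add: c_def)
  have q: "(norm y)\<^sup>2 \<le> 2 * (x y)\<^sup>2 + 2 * c\<^sup>2" for y
  proof -
    have "(norm y)\<^sup>2 \<le> (x y + c)\<^sup>2" using ny[of y] by (intro power_mono) auto
    also have "\<dots> \<le> 2 * (x y)\<^sup>2 + 2 * c\<^sup>2"
      using zero_le_power2[of "x y - c"] by (simp add: power2_eq_square algebra_simps)
    finally show ?thesis .
  qed
  have intb: "integrable lborel (\<lambda>y. (\<alpha> + \<beta> * (x y)\<^sup>2) * ?N y)" for \<alpha> \<beta>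
    using integrable_normal_vec_density[of 1 \<theta>] integrable_normal_vec_density_second_moment[of 1 \<theta> \<theta>]
    by (simp add: x_def ring_distribs mult.assoc)
  have yb: "\<bar>y \<bullet> b\<bar> \<le> norm y" if "b \<in> Basis" for y b :: "real^'p"
    using that by (rule Basis_le_norm)
  have intF: "integrable lborel (F b)" if b: "b \<in> Basis" for b
  proof (rule Bochner_Integration.integrable_bound[OF intb[of "A * (1 + 2 * c\<^sup>2)" "A * 2"]])
    show "F b \<in> borel_measurable lborel"
      using borel_measurable_continuous_onI[OF contF] by simp
    have "\<bar>\<psi> (y \<bullet> y) * (y \<bullet> b)\<bar> \<le> A * (1 + 2 * c\<^sup>2) + A * 2 * (x y)\<^sup>2" for y
    proof -
      \<comment> \<open>From \<open>(norm y - 1)^2 \<ge> 0\<close> and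
        \<open>norm y \<ge> 0\<close>.\<close>
      have "norm y \<le> 1 + (norm y)\<^sup>2"
        using zero_le_power2[of "norm y - 1"] norm_ge_zero[of y]
        unfolding power2_eq_square left_diff_distrib right_diff_distrib by linarith
      then have "\<bar>\<psi> (y \<bullet> y)\<bar> * \<bar>y \<bullet> b\<bar> \<le> A * (1 + (2 * (x y)\<^sup>2 + 2 * c\<^sup>2))"
        using A A0 yb[OF b, of y] q[of y] by (intro mult_mono) auto
      then show ?thesis by (simp add: abs_mult algebra_simps)
    qed
    then have "\<bar>\<psi> (y \<bullet> y) * (y \<bullet> b)\<bar> * ?N y \<le> \<bar>(A * (1 + 2 * c\<^sup>2) + A * 2 * (x y)\<^sup>2) * ?N y\<bar>" for y
      unfolding abs_mult[of _ "?N y"] by (intro mult_mono) (auto intro: order_trans[OF _ abs_ge_self])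
    then show "AE y in lborel. norm (F b y) \<le> norm ((A * (1 + 2 * c\<^sup>2) + A * 2 * (x y)\<^sup>2) * ?N y)"
      by (simp add: F_def abs_mult)
  qed
  have intD: "integrable lborel (D b)" if b: "b \<in> Basis" for b
  proof (rule Bochner_Integration.integrable_bound[OF intb[of "4 * B * c\<^sup>2 + A + A * c\<^sup>2" "4 * B + A * 2"]])
    show "D b \<in> borel_measurable lborel"
      using borel_measurable_continuous_onI[OF contD] by simp
    have "\<bar>2 * \<psi>' (y \<bullet> y) * (y \<bullet> b)\<^sup>2 + \<psi> (y \<bullet> y) * (b \<bullet> b) - \<psi> (y \<bullet> y) * (y \<bullet> b) * ((y - \<theta>) \<bullet> b)\<bar>
      \<le> 4 * B * c\<^sup>2 + A + A * c\<^sup>2 + (4 * B + A * 2) * (x y)\<^sup>2" for y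
    proof -
      have "(y \<bullet> b)\<^sup>2 \<le> (norm y)\<^sup>2"
        using power_mono[OF yb[OF b, of y], of 2] by simp
      then have "(2 * \<bar>\<psi>' (y \<bullet> y)\<bar>) * (y \<bullet> b)\<^sup>2 \<le> (2 * B) * (2 * (x y)\<^sup>2 + 2 * c\<^sup>2)"
        using B[of "y \<bullet> y"] B0 q[of y] by (intro mult_mono) auto
      then have 1: "\<bar>2 * \<psi>' (y \<bullet> y) * (y \<bullet> b)\<^sup>2\<bar> \<le> (2 * B) * (2 * (x y)\<^sup>2 + 2 * c\<^sup>2)"
        by (simp add: abs_mult)
      have 2: "\<bar>\<psi> (y \<bullet> y) * (b \<bullet> b)\<bar> \<le> A"
        using b A[of "y \<bullet> y"] by (simp add: inner_same_Basis)
      have "\<bar>y \<bullet> b\<bar> * \<bar>(y - \<theta>) \<bullet> b\<bar> \<le> (x y + c) * x y"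
        using yb[OF b, of y] ny[of y] yb[OF b, of "y - \<theta>"] x0 c0
        by (intro mult_mono) (auto simp: x_def)
      also have "\<dots> \<le> 2 * (x y)\<^sup>2 + c\<^sup>2"
        using zero_le_power2[of "x y - c"] mult_nonneg_nonneg[OF x0[of y] c0]
        by (simp add: power2_eq_square left_diff_distrib distrib_left distrib_right right_diff_distrib mult.commute)
      finally have "\<bar>\<psi> (y \<bullet> y)\<bar> * (\<bar>y \<bullet> b\<bar> * \<bar>(y - \<theta>) \<bullet> b\<bar>) \<le> A * (2 * (x y)\<^sup>2 + c\<^sup>2)"
        using A[of "y \<bullet> y"] A0 by (intro mult_mono) auto
      then have 3: "\<bar>\<psi> (y \<bullet> y) * (y \<bullet> b) * ((y - \<theta>) \<bullet> b)\<bar> \<le> A * (2 * (x y)\<^sup>2 + c\<^sup>2)"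
        by (simp add: abs_mult mult.assoc)
      show ?thesis using 1 2 3 by (simp add: algebra_simps)
    qed
    then have "\<bar>2 * \<psi>' (y \<bullet> y) * (y \<bullet> b)\<^sup>2 + \<psi> (y \<bullet> y) * (b \<bullet> b) - \<psi> (y \<bullet> y) * (y \<bullet> b) * ((y - \<theta>) \<bullet> b)\<bar> * ?N y
      \<le> \<bar>(4 * B * c\<^sup>2 + A + A * c\<^sup>2 + (4 * B + A * 2) * (x y)\<^sup>2) * ?N y\<bar>" for y
      unfolding abs_mult[of _ "?N y"] by (intro mult_mono) (auto intro: order_trans[OF _ abs_ge_self])
    then show "AE y in lborel. norm (D b y) \<le> norm ((4 * B * c\<^sup>2 + A + A * c\<^sup>2 + (4 * B + A * 2) * (x y)\<^sup>2) * ?N y)"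
      by (simp add: D_def abs_mult)
  qed
  have D0: "(\<integral>y. D b y \<partial>lborel) = 0" if "b \<in> Basis" for b
    using derF contD intF[OF that] intD[OF that] by (rule integral_directional_derivative_eq_0)
  \<comment> \<open>Summing over an orthonormal basis turns the directional derivatives into a
    divergence; together with \<open>D0\<close> this is Stein's identity.\<close>
  have sumD: "(\<Sum>b\<in>Basis. D b y) = (2 * \<psi>' (y \<bullet> y) * (y \<bullet> y) + real CARD('p) * \<psi> (y \<bullet> y) - \<psi> (y \<bullet> y) * (y \<bullet> (y - \<theta>))) * ?N y" for y
  proof -
    have "(\<Sum>b\<in>(Basis :: (real^'p) set). b \<bullet> b) = (\<Sum>b\<in>(Basis :: (real^'p) set). 1)"
      by (intro sum.cong) (auto simp: inner_same_Basis)
    then have 1: "(\<Sum>b\<in>(Basis :: (real^'p) set). b \<bullet> b) = real CARD('p)" by simp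
    have "(\<Sum>b\<in>Basis. D b y) = (2 * \<psi>' (y \<bullet> y) * (\<Sum>b\<in>Basis. (y \<bullet> b)\<^sup>2) + \<psi> (y \<bullet> y) * (\<Sum>b\<in>(Basis :: (real^'p) set). b \<bullet> b)
      - \<psi> (y \<bullet> y) * (\<Sum>b\<in>Basis. (y \<bullet> b) * ((y - \<theta>) \<bullet> b))) * ?N y"
      unfolding D_def sum_distrib_right[symmetric] by (simp add: sum.distrib sum_subtractf sum_distrib_left mult.assoc)
    moreover have "(\<Sum>b\<in>Basis. (y \<bullet> b)\<^sup>2) = y \<bullet> y"
      unfolding power2_eq_square by (rule euclidean_inner[symmetric])
    moreover have "(\<Sum>b\<in>Basis. (y \<bullet> b) * ((y - \<theta>) \<bullet> b)) = y \<bullet> (y - \<theta>)"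
      by (rule euclidean_inner[symmetric])
    ultimately show ?thesis by (simp only: 1 mult.commute)
  qed
  \<comment> \<open>Hypothesis \<open>le\<close> absorbs the term quadratic in \<psi>. What remains
    beyond the loss of the identity rule is twice the divergence, which integrates to zero.\<close>
  have pt: "(norm (\<theta> - (y - \<psi> ((norm y)\<^sup>2) *\<^sub>R y)))\<^sup>2 * ?N y \<le> (norm (y - \<theta>))\<^sup>2 * ?N y + 2 * (\<Sum>b\<in>Basis. D b y)" for y
  proof -
    let ?s = "\<psi> (y \<bullet> y)"
    have "(norm (\<theta> - (y - \<psi> ((norm y)\<^sup>2) *\<^sub>R y)))\<^sup>2 = (norm (y - \<theta>))\<^sup>2 - 2 * ?s * (y \<bullet> (y - \<theta>)) + (y \<bullet> y) * ?s\<^sup>2"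
      unfolding power2_norm_eq_inner by (simp add: inner_simps inner_commute power2_eq_square algebra_simps)
    also have "\<dots> \<le> (norm (y - \<theta>))\<^sup>2 + 2 * (2 * \<psi>' (y \<bullet> y) * (y \<bullet> y) + real CARD('p) * ?s - ?s * (y \<bullet> (y - \<theta>)))"
      using le[of "y \<bullet> y"] by (simp add: algebra_simps)
    finally show ?thesis
      unfolding sumD using mult_right_mono[OF _ normal_vec_density_nonneg[of \<theta> 1 y]] by (fastforce simp: algebra_simps)
  qed
  have \<psi>m[measurable]: "\<psi> \<in> borel_measurable borel"
    using borel_measurable_continuous_onI[OF cont\<psi>] .
  have "risk \<theta> (\<lambda>y. y - \<psi> ((norm y)\<^sup>2) *\<^sub>R y) =
      (\<integral>\<^sup>+y. ennreal ((norm (\<theta> - (y - \<psi> ((norm y)\<^sup>2) *\<^sub>R y)))\<^sup>2 * ?N y) \<partial>lborel)"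
    unfolding risk_def by (subst nn_integral_density_normal_vec) (simp_all add: ennreal_mult)
  also have "\<dots> \<le> (\<integral>\<^sup>+y. ennreal ((norm (y - \<theta>))\<^sup>2 * ?N y + 2 * (\<Sum>b\<in>Basis. D b y)) \<partial>lborel)"
    by (intro nn_integral_mono ennreal_leI pt)
  also have "\<dots> = ennreal (\<integral>y. (norm (y - \<theta>))\<^sup>2 * ?N y + 2 * (\<Sum>b\<in>Basis. D b y) \<partial>lborel)"
  proof (rule nn_integral_eq_integral)
    show "integrable lborel (\<lambda>y. (norm (y - \<theta>))\<^sup>2 * ?N y + 2 * (\<Sum>b\<in>Basis. D b y))"
      using intD integrable_normal_vec_density_second_moment[of 1 \<theta> \<theta>] by simp
    show "AE y in lborel. 0 \<le> (norm (y - \<theta>))\<^sup>2 * ?N y + 2 * (\<Sum>b\<in>Basis. D b y)"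
      by (intro AE_I2 order_trans[OF _ pt]) simp
  qed
  also have "(\<integral>y. (norm (y - \<theta>))\<^sup>2 * ?N y + 2 * (\<Sum>b\<in>Basis. D b y) \<partial>lborel) = real CARD('p)"
    using intD D0 integrable_normal_vec_density_second_moment[of 1 \<theta> \<theta>] by simp
  finally show ?thesis .
qed

section \<open>The shrinkage factor\<close>

text \<open>For \<open>k \<ge> 2\<close>, the substitution \<open>L = 1 / (1 + w)\<close> gives the
  integral of \<open>L ^ (k - 2) * exp (- s * L)\<close> over the unit interval, an incomplete gamma
  integral if \<open>s > 0\<close>. The variable w is kept because it is that of the
  hyperprior.\<close>

definition laplace_int :: "nat \<Rightarrow> real \<Rightarrow> real" where
  "laplace_int k s = (\<integral>w. indicator {0..} w * ((1 / (1 + w)) ^ k * exp (- (s / (1 + w)))) \<partial>lborel)"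

text \<open>The majorant is a multiple of \<open>(1 + w)^(-2)\<close>, with antiderivative
  \<open>- 1 / (1 + w)\<close>; the exponential is at most \<open>exp \<bar>s\<bar>\<close>.
  Negative s is included so that the derivative in s exists on the whole line, also at 0.\<close>

lemma integrable_laplace_int:
  fixes s :: real
  assumes "2 \<le> k"
  shows "integrable lborel (\<lambda>w. indicator {0..} w * ((1 / (1 + w)) ^ k * exp (- (s / (1 + w)))))"
proof -
  have "((\<lambda>w. - (1 / (1 + w))) \<longlongrightarrow> - 0) (at_top :: real filter)"
    by (intro tendsto_minus tendsto_divide_0[OF tendsto_const] filterlim_at_top_imp_at_infinity
        filterlim_tendsto_add_at_top[OF tendsto_const] filterlim_ident)
  then have "(\<integral>\<^sup>+w. ennreal ((1 / (1 + w))\<^sup>2) * indicator {0..} w \<partial>lborel) = ennreal (- 0 - (- (1 / (1 + 0))))"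
    by (intro nn_integral_FTC_atLeast)
       (auto intro!: derivative_eq_intros simp: field_simps power2_eq_square)
  then have fin: "(\<integral>\<^sup>+w. ennreal (indicator {0..} w * (1 / (1 + w))\<^sup>2) \<partial>lborel) < \<infinity>"
    by (simp add: indicator_mult_ennreal mult.commute)
  have "integrable lborel (\<lambda>w::real. indicator {0..} w * (1 / (1 + w))\<^sup>2)"
    by (rule integrableI_nonneg) (use fin in auto)
  then have "integrable lborel (\<lambda>w::real. exp \<bar>s\<bar> * (indicator {0..} w * (1 / (1 + w))\<^sup>2))"
    by simp
  then show ?thesis
  proof (rule Bochner_Integration.integrable_bound)
    have "(1 / (1 + w)) ^ k * exp (- (s / (1 + w))) \<le> exp \<bar>s\<bar> * (1 / (1 + w))\<^sup>2" if w: "0 \<le> w" for w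
    proof -
      have "(- s) / (1 + w) \<le> \<bar>s\<bar> / (1 + w)" using w by (intro divide_right_mono) auto
      also have "\<dots> \<le> \<bar>s\<bar> / 1" using w by (intro divide_left_mono) auto
      finally have "exp (- (s / (1 + w))) \<le> exp \<bar>s\<bar>" by simp
      moreover have "(1 / (1 + w)) ^ k \<le> (1 / (1 + w))\<^sup>2"
        using w assms by (intro power_decreasing) auto
      ultimately have "(1 / (1 + w)) ^ k * exp (- (s / (1 + w))) \<le> (1 / (1 + w))\<^sup>2 * exp \<bar>s\<bar>"
        using w by (intro mult_mono) auto
      then show ?thesis by (simp add: mult.commute)
    qed
    then show "AE w in lborel. norm (indicator {0..} w * ((1 / (1 + w)) ^ k * exp (- (s / (1 + w)))))
        \<le> norm (exp \<bar>s\<bar> * (indicator {0..} w * (1 / (1 + w))\<^sup>2))"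
      by (intro AE_I2) (auto simp: abs_mult split: split_indicator)
  qed simp
qed

lemma laplace_int_pos:
  assumes "2 \<le> k"
  shows "0 < laplace_int k s"
proof -
  let ?f = "\<lambda>w::real. indicator {0..} w * ((1 / (1 + w)) ^ k * exp (- (s / (1 + w))))"
  have nn: "0 \<le> ?f w" for w by (auto split: split_indicator)
  have "laplace_int k s \<noteq> 0"
  proof
    assume "laplace_int k s = 0"
    then have "AE w in lborel. ?f w = 0"
      using integral_nonneg_eq_0_iff_AE[OF integrable_laplace_int[OF assms, of s]] nn
      by (simp add: laplace_int_def)
    \<comment> \<open>The unit interval is a set of positive measure on which the integrand does not
      vanish.\<close>
    then have "AE w in lborel. w \<notin> {0..1::real}"
      by eventually_elim (auto simp: add_nonneg_eq_0_iff)
    then have "{0..1::real} \<in> null_sets lborel"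
      by (subst AE_iff_null_sets) auto
    then show False by (auto dest: null_setsD1)
  qed
  moreover have "0 \<le> laplace_int k s"
    unfolding laplace_int_def using nn by simp
  ultimately show ?thesis by simp
qed

lemma laplace_int_Suc_le:
  assumes "2 \<le> k"
  shows "laplace_int (Suc k) s \<le> laplace_int k s"
proof -
  have "(1 / (1 + w)) ^ Suc k * e \<le> (1 / (1 + w)) ^ k * e" if "0 \<le> w" "0 \<le> e" for w e :: real
    using that by (intro mult_right_mono power_decreasing) auto
  then show ?thesis
    unfolding laplace_int_def using assms
    by (intro integral_mono integrable_laplace_int) (auto simp del: power_Suc split: split_indicator)
qed

section \<open>Differentiation under the integral sign and integration by parts\<close>

lemma exp_le_quadratic:
  fixes x :: real
  assumes "\<bar>x\<bar> \<le> 1"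
  shows "exp x \<le> 1 + x + x\<^sup>2"
proof (cases "0 \<le> x")
  case True
  then show ?thesis using assms by (intro exp_bound) auto
next
  case False
  have "1 - x \<le> exp (- x)" using exp_ge_add_one_self[of "- x"] by simp
  then have "exp x \<le> 1 / (1 - x)"
    using False by (simp add: exp_minus field_simps)
  \<comment> \<open>\<open>(1 - x) * (1 + x + x^2) = 1 - x^3\<close>, which is at least 1 for
    negative x.\<close>
  also have "\<dots> \<le> 1 + x + x\<^sup>2"
  proof -
    have "x ^ 3 \<le> 0" using False by (simp add: power_le_zero_eq)
    then show ?thesis using False by (simp add: field_simps power2_eq_square power3_eq_cube)
  qed
  finally show ?thesis .
qed

text \<open>With \<open>L = 1 / (1 + w)\<close>, the remainder of \<open>exp (- h * L)\<close> after
  its linear term is at most \<open>(h * L)^2 \<le> h^2\<close>. Integrated, this bounds the error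
  of the difference quotient by \<open>\<bar>h\<bar> * laplace_int k s\<close>.\<close>

lemma laplace_int_deriv:
  assumes k: "2 \<le> k"
  shows "(laplace_int k has_real_derivative - laplace_int (Suc k) s) (at s)"
proof -
  have bound: "\<bar>laplace_int k (s + h) - laplace_int k s + h * laplace_int (Suc k) s\<bar> \<le> h\<^sup>2 * laplace_int k s"
    if h: "\<bar>h\<bar> \<le> 1" for h
  proof -
    let ?f = "\<lambda>k s w. indicator {0..} w * ((1 / (1 + w)) ^ k * exp (- (s / (1 + w))))"
    have int: "integrable lborel (?f k (s + h))" "integrable lborel (?f k s)" "integrable lborel (?f (Suc k) s)"
      using k by (intro integrable_laplace_int; simp)+
    have eq: "laplace_int k (s + h) - laplace_int k s + h * laplace_int (Suc k) s
        = (\<integral>w. ?f k (s + h) w - ?f k s w + h * ?f (Suc k) s w \<partial>lborel)"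
      using Bochner_Integration.integral_add[OF Bochner_Integration.integrable_diff[OF int(1,2)] integrable_mult_right[OF int(3), of h]]
        Bochner_Integration.integral_diff[OF int(1,2)]
      by (simp add: laplace_int_def del: power_Suc)
    have "\<bar>?f k (s + h) w - ?f k s w + h * ?f (Suc k) s w\<bar> \<le> h\<^sup>2 * ?f k s w" for w
    proof (cases "0 \<le> w")
      case True
      define L where "L = 1 / (1 + w)"
      have L: "0 \<le> L" "L \<le> 1" using True by (auto simp: L_def)
      have hL: "\<bar>- (h * L)\<bar> \<le> \<bar>h\<bar>" using L by (simp add: abs_mult mult_left_le)
      have 1: "exp (- (h * L)) \<le> 1 + (- (h * L)) + (- (h * L))\<^sup>2"
        using hL h by (intro exp_le_quadratic) linarith
      have 2: "1 + (- (h * L)) \<le> exp (- (h * L))" by (rule exp_ge_add_one_self)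
      have 3: "(h * L)\<^sup>2 \<le> h\<^sup>2"
        using hL by (simp add: abs_le_square_iff)
      have "\<bar>exp (- (h * L)) - 1 + h * L\<bar> \<le> h\<^sup>2" using 1 2 3 by simp
      then have "(L ^ k * exp (- (s * L))) * \<bar>exp (- (h * L)) - 1 + h * L\<bar> \<le> (L ^ k * exp (- (s * L))) * h\<^sup>2"
        using L by (intro mult_left_mono) auto
      moreover have "(L ^ k * exp (- (s * L))) * \<bar>exp (- (h * L)) - 1 + h * L\<bar> =
          \<bar>(L ^ k * exp (- (s * L))) * (exp (- (h * L)) - 1 + h * L)\<bar>"
        using L by (simp add: abs_mult)
      moreover have "(L ^ k * exp (- (s * L))) * (exp (- (h * L)) - 1 + h * L) =
          L ^ k * exp (- ((s + h) * L)) - L ^ k * exp (- (s * L)) + h * (L ^ Suc k * exp (- (s * L)))"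
        by (simp add: algebra_simps exp_add[symmetric] exp_diff exp_minus divide_inverse)
      ultimately have "\<bar>L ^ k * exp (- ((s + h) * L)) - L ^ k * exp (- (s * L)) + h * (L ^ Suc k * exp (- (s * L)))\<bar>
          \<le> h\<^sup>2 * (L ^ k * exp (- (s * L)))"
        by (simp add: mult.commute)
      then show ?thesis using True by (simp add: L_def)
    qed simp
    then have "\<bar>\<integral>w. ?f k (s + h) w - ?f k s w + h * ?f (Suc k) s w \<partial>lborel\<bar> \<le> (\<integral>w. h\<^sup>2 * ?f k s w \<partial>lborel)"
      using Bochner_Integration.integrable_add[OF Bochner_Integration.integrable_diff[OF int(1,2)] integrable_mult_right[OF int(3), of h]]
        integrable_mult_right[OF int(2), of "h\<^sup>2"]
      by (intro integral_abs_bound_integral) auto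
    then show ?thesis unfolding eq by (simp add: laplace_int_def)
  qed
  have "((\<lambda>h. (laplace_int k (s + h) - laplace_int k s) / h + laplace_int (Suc k) s) \<longlongrightarrow> 0) (at 0)"
  proof (rule tendsto_0_le[where K = "laplace_int k s"])
    show "((\<lambda>h::real. h) \<longlongrightarrow> 0) (at 0)" by (rule tendsto_ident_at)
    show "\<forall>\<^sub>F h in at 0. norm ((laplace_int k (s + h) - laplace_int k s) / h + laplace_int (Suc k) s) \<le> norm h * laplace_int k s"
      unfolding eventually_at
    proof (intro exI[of _ 1] conjI ballI impI, simp)
      fix h :: real assume "h \<noteq> 0 \<and> dist h 0 < 1"
      then have h: "h \<noteq> 0" "\<bar>h\<bar> \<le> 1" by auto
      have "norm ((laplace_int k (s + h) - laplace_int k s) / h + laplace_int (Suc k) s)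
          = \<bar>laplace_int k (s + h) - laplace_int k s + h * laplace_int (Suc k) s\<bar> / \<bar>h\<bar>"
        using h by (simp add: field_simps flip: abs_divide)
      also have "\<dots> \<le> h\<^sup>2 * laplace_int k s / \<bar>h\<bar>"
        by (intro divide_right_mono bound h) simp
      also have "\<dots> = norm h * laplace_int k s"
        using h by (simp add: power2_eq_square abs_if)
      finally show "norm ((laplace_int k (s + h) - laplace_int k s) / h + laplace_int (Suc k) s) \<le> norm h * laplace_int k s" .
    qed
  qed
  from tendsto_diff[OF this tendsto_const[of "laplace_int (Suc k) s"]]
  show ?thesis by (simp add: DERIV_def)
qed

text \<open>With \<open>L = 1 / (1 + w)\<close>, the integrand of
  \<open>s * laplace_int (m + 2) s - m * laplace_int (m + 1) s\<close> is the derivative in w of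
  \<open>L ^ m * exp (- s * L)\<close>, which tends to 0 at infinity because
  \<open>m \<ge> 1\<close> and equals \<open>exp (- s)\<close> at \<open>w = 0\<close>.\<close>

lemma laplace_int_recurrence:
  assumes m: "1 \<le> m"
  shows "s * laplace_int (m + 2) s = real m * laplace_int (m + 1) s - exp (- s)"
proof -
  let ?f = "\<lambda>k w. (1 / (1 + w)) ^ k * exp (- (s / (1 + w)))"
  let ?g = "\<lambda>w. s * ?f (m + 2) w - real m * ?f (m + 1) w"
  have int: "integrable lborel (\<lambda>w. indicator {0..} w * ?f k w)" if "2 \<le> k" for k
    using integrable_laplace_int[OF that] .
  have eq: "indicator {0..} w *\<^sub>R ?g w = s * (indicator {0..} w * ?f (m + 2) w) - real m * (indicator {0..} w * ?f (m + 1) w)" for w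
    by (simp add: algebra_simps)
  have ig: "integrable lborel (\<lambda>w. indicator {0..} w *\<^sub>R ?g w)"
    unfolding eq using m by (intro Bochner_Integration.integrable_diff integrable_mult_right int) auto
  have val: "(\<integral>w. indicator {0..} w *\<^sub>R ?g w \<partial>lborel) = s * laplace_int (m + 2) s - real m * laplace_int (m + 1) s"
    unfolding eq laplace_int_def using m
    by (subst Bochner_Integration.integral_diff) (auto intro!: integrable_mult_right int simp del: power_Suc)
  have ioi: "set_integrable lborel (einterval 0 \<infinity>) ?g"
    by (rule set_integrable_subset[of _ "{0..}"]) (use ig in \<open>auto simp: set_integrable_def einterval_def zero_ereal_def\<close>)
  have lim0: "((\<lambda>w. 1 / (1 + w)) \<longlongrightarrow> (0::real)) at_top"
    by (intro tendsto_divide_0[OF tendsto_const] filterlim_at_top_imp_at_infinity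
        filterlim_tendsto_add_at_top[OF tendsto_const] filterlim_ident)
  have "((\<lambda>w. (1 / (1 + w)) ^ m * exp (- (s * (1 / (1 + w))))) \<longlongrightarrow> 0 ^ m * exp (- (s * 0))) at_top"
    by (intro tendsto_intros lim0)
  then have lim: "(?f m \<longlongrightarrow> 0) at_top" using m by (simp add: power_0_left)
  have "(LBINT w=0..\<infinity>. ?g w) = 0 - exp (- s)"
  proof (rule interval_integral_FTC_integrable[where F = "?f m"])
    show "(?f m has_vector_derivative ?g w) (at w)" if "0 < ereal w" "ereal w < \<infinity>" for w
    proof -
      have w: "0 < w" using that by simp
      have "(?f m has_real_derivative
          real m * (1 / (1 + w)) ^ (m - 1) * (- (1 / (1 + w)\<^sup>2)) * exp (- (s / (1 + w)))
          + (1 / (1 + w)) ^ m * (exp (- (s / (1 + w))) * (s / (1 + w)\<^sup>2))) (at w)"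
        using w by (auto intro!: derivative_eq_intros simp: power2_eq_square)
      also have "real m * (1 / (1 + w)) ^ (m - 1) * (- (1 / (1 + w)\<^sup>2)) * exp (- (s / (1 + w)))
          + (1 / (1 + w)) ^ m * (exp (- (s / (1 + w))) * (s / (1 + w)\<^sup>2)) = ?g w"
      proof -
        \<comment> \<open>Removes the truncated difference \<open>m - 1\<close> from the
          exponent.\<close>
        obtain j where j: "m = Suc j" using m by (cases m) auto
        show ?thesis unfolding j using w by (simp add: field_simps power2_eq_square)
      qed
      finally show ?thesis by (simp add: has_real_derivative_iff_has_vector_derivative)
    qed
    show "isCont ?g w" if "0 < ereal w" "ereal w < \<infinity>" for w
      using that by (intro continuous_intros) auto
    have "isCont (?f m) 0" by (intro continuous_intros) auto
    then have "(?f m \<longlongrightarrow> exp (- s)) (at_right 0)"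
      unfolding isCont_def by (simp add: filterlim_at_split)
    then show "((?f m \<circ> real_of_ereal) \<longlongrightarrow> exp (- s)) (at_right 0)"
      unfolding zero_ereal_def ereal_tendsto_simps .
    show "((?f m \<circ> real_of_ereal) \<longlongrightarrow> 0) (at_left \<infinity>)"
      unfolding ereal_tendsto_simps by (rule lim)
  qed (use ioi in auto)
  moreover have "(LBINT w=0..\<infinity>. ?g w) = (\<integral>w. indicator {0..} w *\<^sub>R ?g w \<partial>lborel)"
  proof -
    \<comment> \<open>\<open>einterval 0 \<infinity>\<close> is open at 0, while
      \<open>laplace_int\<close> integrates over a half-line closed at 0; they differ in a null
      set.\<close>
    have "AE w in lborel. indicator (einterval 0 \<infinity>) w *\<^sub>R ?g w = indicator {0..} w *\<^sub>R ?g w"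
      using AE_lborel_singleton[of 0] by eventually_elim (auto simp: einterval_def split: split_indicator)
    then show ?thesis
      unfolding interval_lebesgue_integral_def set_lebesgue_integral_def
      by (simp del: power_Suc) (intro integral_cong_AE, auto simp del: power_Suc)
  qed
  ultimately show ?thesis using val by simp
qed

text \<open>The posterior mean of \<open>1 / (1 + w)\<close> when \<open>(norm y)^2 = r\<close>; the
  half is the one in the exponent of the normal density.\<close>

definition shrink_factor :: "nat \<Rightarrow> real \<Rightarrow> real" where
  "shrink_factor p r = laplace_int p (r / 2) / laplace_int (p - 1) (r / 2)"

text \<open>Minus half the posterior variance of \<open>1 / (1 + w)\<close>.\<close>

definition shrink_factor_deriv :: "nat \<Rightarrow> real \<Rightarrow> real" where
  "shrink_factor_deriv p r = ((shrink_factor p r)\<^sup>2 - laplace_int (p + 1) (r / 2) / laplace_int (p - 1) (r / 2)) / 2"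

text \<open>The five claims match the hypotheses of \<open>risk_shrinkage_le\<close>, in that order
  and with both bounds equal to 1. The bounds hold because \<open>laplace_int\<close> decreases in
  the exponent.\<close>

lemma shrink_factor:
  assumes p: "3 \<le> p"
  shows "(shrink_factor p has_real_derivative shrink_factor_deriv p r) (at r)" and "continuous_on UNIV (shrink_factor_deriv p)"
    and "\<bar>shrink_factor p r\<bar> \<le> 1" and "\<bar>shrink_factor_deriv p r\<bar> \<le> 1"
    and "r * (shrink_factor p r)\<^sup>2 \<le> 2 * real p * shrink_factor p r + 4 * r * shrink_factor_deriv p r"
proof -
  have Sp: "Suc (p - 1) = p" and Sp2: "Suc p = p + 1" using p by auto
  have pos: "0 < laplace_int (p - 1) s" "0 < laplace_int p s" "0 < laplace_int (p + 1) s" for s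
    using p by (auto intro!: laplace_int_pos)
  have mono: "laplace_int p s \<le> laplace_int (p - 1) s" "laplace_int (p + 1) s \<le> laplace_int p s" for s
    using laplace_int_Suc_le[of "p - 1" s] laplace_int_Suc_le[of p s] p unfolding Sp Sp2 by auto
  have d: "((\<lambda>r. laplace_int k (r / 2)) has_real_derivative - laplace_int (Suc k) (r / 2) / 2) (at r)" if "2 \<le> k" for k r
  proof -
    have "((\<lambda>r. r / 2) has_real_derivative 1 / 2) (at r)"
      by (auto intro!: derivative_eq_intros)
    from DERIV_chain2[where f = "laplace_int k", OF laplace_int_deriv[OF that] this] show ?thesis by simp
  qed
  show der: "(shrink_factor p has_real_derivative shrink_factor_deriv p r) (at r)" for r
  proof -
    have "(shrink_factor p has_real_derivative
      ((- laplace_int (Suc p) (r / 2) / 2) * laplace_int (p - 1) (r / 2) - laplace_int p (r / 2) * (- laplace_int (Suc (p - 1)) (r / 2) / 2))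
        / (laplace_int (p - 1) (r / 2) * laplace_int (p - 1) (r / 2))) (at r)"
      unfolding shrink_factor_def[abs_def] using p pos(1)[of "r / 2"] by (intro DERIV_divide d) auto
    also have "((- laplace_int (Suc p) (r / 2) / 2) * laplace_int (p - 1) (r / 2) - laplace_int p (r / 2) * (- laplace_int (Suc (p - 1)) (r / 2) / 2))
        / (laplace_int (p - 1) (r / 2) * laplace_int (p - 1) (r / 2)) = shrink_factor_deriv p r"
      using pos(1)[of "r / 2"] unfolding shrink_factor_deriv_def[abs_def] shrink_factor_def[abs_def] Sp Sp2 by (simp add: field_simps power2_eq_square)
    finally show ?thesis .
  qed
  have cont: "continuous_on UNIV (\<lambda>r. laplace_int k (r / 2))" if "2 \<le> k" for k
    using d[OF that] by (intro continuous_at_imp_continuous_on ballI DERIV_isCont)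
  have "continuous_on UNIV (shrink_factor p)"
    using der by (intro continuous_at_imp_continuous_on ballI DERIV_isCont)
  then show "continuous_on UNIV (shrink_factor_deriv p)"
    unfolding shrink_factor_deriv_def[abs_def] using p pos(1) by (intro continuous_intros cont) (auto simp: less_imp_neq[symmetric])
  have r01: "0 \<le> shrink_factor p r" "shrink_factor p r \<le> 1" "0 \<le> laplace_int (p + 1) (r / 2) / laplace_int (p - 1) (r / 2)"
    "laplace_int (p + 1) (r / 2) / laplace_int (p - 1) (r / 2) \<le> 1" for r
    using pos[of "r / 2"] mono[of "r / 2"] by (auto simp: shrink_factor_def[abs_def])
  show "\<bar>shrink_factor p r\<bar> \<le> 1" using r01[of r] by simp
  have "(shrink_factor p r)\<^sup>2 \<le> 1" using r01[of r] by (simp add: power_le_one)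
  moreover have abs_diff_le_0_1: "\<bar>(u - v) / 2\<bar> \<le> 1" if "0 \<le> u" "u \<le> 1" "0 \<le> v" "v \<le> 1" for u v :: real
    using that by (simp add: abs_le_iff)
  ultimately show "\<bar>shrink_factor_deriv p r\<bar> \<le> 1"
    using abs_diff_le_0_1 r01(3,4)[of r] zero_le_power2[of "shrink_factor p r"] unfolding shrink_factor_deriv_def[abs_def] by blast
  define s where "s = r / 2"
  define I0 where "I0 = laplace_int (p - 1) s"
  define I1 where "I1 = laplace_int p s"
  define I2 where "I2 = laplace_int (p + 1) s"
  have 1: "s * I1 = real (p - 2) * I0 - exp (- s)"
    using laplace_int_recurrence[of "p - 2" s] p
    by (simp add: I0_def I1_def Suc_diff_Suc numeral_2_eq_2)
  have 2: "s * I2 = real (p - 1) * I1 - exp (- s)"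
    using laplace_int_recurrence[of "p - 1" s] p by (simp add: I1_def I2_def)
  have I: "0 < I0" "I1 \<le> I0" using pos mono by (auto simp: I0_def I1_def)
  \<comment> \<open>The boundary term of the recurrence relative to \<open>I0\<close>. In the final
    difference all terms without \<open>e\<close> cancel, and the factor left beside
    \<open>e\<close> is positive since the shrinkage factor is at most 1.\<close>
  define e where "e = exp (- s) / I0"
  have sf: "shrink_factor p r = I1 / I0" and sd: "shrink_factor_deriv p r = ((shrink_factor p r)\<^sup>2 - I2 / I0) / 2"
    by (simp_all add: shrink_factor_def[abs_def] shrink_factor_deriv_def[abs_def] I0_def I1_def I2_def s_def)
  have e1: "s * shrink_factor p r = (real p - 2) - e"
    using 1 I p by (simp add: sf e_def field_simps of_nat_diff)
  have e2: "s * (I2 / I0) = (real p - 1) * shrink_factor p r - e"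
    unfolding times_divide_eq_right 2 sf e_def using p by (simp add: diff_divide_distrib of_nat_diff)
  have "2 * real p * shrink_factor p r + 4 * r * shrink_factor_deriv p r - r * (shrink_factor p r)\<^sup>2
      = 2 * real p * shrink_factor p r + 2 * (s * shrink_factor p r) * shrink_factor p r - 4 * (s * (I2 / I0))"
    unfolding sd by (simp add: s_def power2_eq_square field_simps)
  also have "\<dots> = e * (4 - 2 * shrink_factor p r)"
    unfolding e1 e2 by (simp add: algebra_simps)
  also have "0 \<le> \<dots>"
    using I r01(2)[of r] by (intro mult_nonneg_nonneg) (auto simp: e_def)
  finally show "r * (shrink_factor p r)\<^sup>2 \<le> 2 * real p * shrink_factor p r + 4 * r * shrink_factor_deriv p r" by simp
qed

section \<open>The prior as a normal scale mixture\<close>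

lemma sets_normal_vec [measurable_cong, simp]: "sets (normal_vec m v) = sets borel"
  by (simp add: normal_vec_def)

text \<open>\<open>sqrt\<close> is odd, so a negative v acts as the variance
  \<open>\<bar>v\<bar>\<close>; for \<open>v = 0\<close> division by zero makes the density vanish.
  These cases arise because monadic binding asks for a kernel on all reals.\<close>

lemma subprob_space_normal_vec: "subprob_space (normal_vec (m :: real^'p) v)"
proof
  have "normal_vec_density m v y = (if v = 0 then 0 else normal_vec_density m \<bar>v\<bar> y)" for y
  proof -
    have "(sqrt v)\<^sup>2 = \<bar>v\<bar>"
    proof (cases "0 \<le> v")
      case False
      then show ?thesis using real_sqrt_minus[of "- v"] by simp
    qed simp
    then show ?thesis by (simp add: normal_vec_density_def normal_density_def)
  qed
  then show "emeasure (normal_vec m v) (space (normal_vec m v)) \<le> 1"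
    by (cases "v = 0") (simp_all add: normal_vec_def emeasure_density nn_integral_normal_vec_density)
qed (simp add: normal_vec_def)

lemma measurable_normal_vec [measurable]:
  "normal_vec (m :: real^'p) \<in> borel \<rightarrow>\<^sub>M subprob_algebra borel"
proof (rule measurable_subprob_algebra)
  fix A :: "(real^'p) set" assume [measurable]: "A \<in> sets borel"
  have "(\<lambda>v. \<integral>\<^sup>+y. ennreal (normal_vec_density m v y) * indicator A y \<partial>lborel) \<in> borel_measurable borel"
    by measurable
  then show "(\<lambda>v. emeasure (normal_vec m v) A) \<in> borel_measurable borel"
    by (simp add: normal_vec_def emeasure_density)
qed (simp_all add: subprob_space_normal_vec)

lemma sets_scale_law [measurable_cong, simp]: "sets (scale_law b s) = sets borel"
  by (simp add: scale_law_def)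

lemma borel_measurable_beta_prime_1_density [measurable]: "beta_prime_1_density b \<in> borel_measurable borel"
  unfolding beta_prime_1_density_def[abs_def] by measurable

lemma beta_prime_1_density_nonneg: "0 \<le> b \<Longrightarrow> 0 \<le> beta_prime_1_density b w"
  by (simp add: beta_prime_1_density_def)

lemma nn_integral_beta_prime_1_density:
  assumes "0 < b"
  shows "(\<integral>\<^sup>+w. ennreal (beta_prime_1_density b w) \<partial>lborel) = 1"
proof -
  have "((\<lambda>w. - ((1 + w) powr (- b))) \<longlongrightarrow> - 0) at_top"
    using assms by (intro tendsto_minus tendsto_neg_powr filterlim_tendsto_add_at_top[OF tendsto_const] filterlim_ident) simp
  moreover have "((\<lambda>w. - ((1 + w) powr (- b))) has_real_derivative b * (1 + w) powr (- (b + 1))) (at w)" if "0 \<le> w" for w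
    using DERIV_minus[OF DERIV_chain2[where f = "\<lambda>z. z powr (- b)" and g = "\<lambda>w. 1 + w" and Db = 1, OF has_real_derivative_powr]] that
    by (auto intro!: derivative_eq_intros)
  ultimately have "(\<integral>\<^sup>+w. ennreal (b * (1 + w) powr (- (b + 1))) * indicator {0..} w \<partial>lborel)
      = ennreal (- 0 - (- ((1 + 0) powr (- b))))"
    using assms by (intro nn_integral_FTC_atLeast) auto
  moreover have "AE w in lborel. ennreal (beta_prime_1_density b w) = ennreal (b * (1 + w) powr (- (b + 1))) * indicator {0..} w"
    using AE_lborel_singleton[of 0]
    by eventually_elim (auto simp: beta_prime_1_density_def split: split_indicator)
  then have "(\<integral>\<^sup>+w. ennreal (beta_prime_1_density b w) \<partial>lborel) = (\<integral>\<^sup>+w. ennreal (b * (1 + w) powr (- (b + 1))) * indicator {0..} w \<partial>lborel)"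
    by (rule nn_integral_cong_AE)
  ultimately show ?thesis by simp
qed

text \<open>Substitute \<open>w = u * s\<close>: the factor s in \<open>scale_law\<close> cancels
  the Jacobian. This is what makes W independent of S and k.\<close>

lemma nn_integral_scale_law:
  assumes "0 \<le> b" and [measurable]: "f \<in> borel_measurable borel"
  shows "(\<integral>\<^sup>+u. f (u * s) \<partial>scale_law b s) =
    (if 0 < s then \<integral>\<^sup>+w. f w * ennreal (beta_prime_1_density b w) \<partial>lborel else 0)"
proof -
  have "(\<integral>\<^sup>+u. f (u * s) \<partial>scale_law b s) =
      (\<integral>\<^sup>+u. ennreal (if u > 0 then s * beta_prime_1_density b (u * s) else 0) * f (u * s) \<partial>lborel)"
    unfolding scale_law_def by (rule nn_integral_density) measurable
  also have "\<dots> = (if 0 < s then \<integral>\<^sup>+w. f w * ennreal (beta_prime_1_density b w) \<partial>lborel else 0)"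
  proof (cases "0 < s")
    case True
    \<comment> \<open>The summand 0 brings the integrand into the form of the affine substitution
      rule.\<close>
    have "ennreal (if u > 0 then s * beta_prime_1_density b (u * s) else 0) * f (u * s)
        = ennreal s * (f (0 + s * u) * ennreal (beta_prime_1_density b (0 + s * u)))" for u
      using True assms(1)
      by (auto simp: beta_prime_1_density_def ennreal_mult mult_ac zero_less_mult_iff)
    then show ?thesis
      using True by (subst nn_integral_real_affine[where c = s and t = 0]) (simp_all add: nn_integral_cmult)
  next
    case False
    then have "(if u > 0 then s * beta_prime_1_density b (u * s) else 0) = 0" for u
      by (auto simp: beta_prime_1_density_def zero_less_mult_iff)
    then show ?thesis using False by simp
  qed
  finally show ?thesis .
qed

lemma subprob_space_scale_law:
  assumes "0 < b"
  shows "subprob_space (scale_law b s)"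
proof
  have "emeasure (scale_law b s) (space (scale_law b s)) = (\<integral>\<^sup>+u. 1 \<partial>scale_law b s)" by simp
  also have "\<dots> \<le> 1"
    using nn_integral_scale_law[of b "\<lambda>_. 1" s] assms by (simp add: nn_integral_beta_prime_1_density)
  finally show "emeasure (scale_law b s) (space (scale_law b s)) \<le> 1" .
qed (simp add: scale_law_def)

lemma measurable_scale_law:
  assumes "0 < b"
  shows "scale_law b \<in> borel \<rightarrow>\<^sub>M subprob_algebra borel"
proof (rule measurable_subprob_algebra)
  fix A :: "real set" assume [measurable]: "A \<in> sets borel"
  have "(\<lambda>s. \<integral>\<^sup>+u. ennreal (if u > 0 then s * beta_prime_1_density b (u * s) else 0) * indicator A u \<partial>lborel) \<in> borel_measurable borel"
    by measurable
  then show "(\<lambda>s. emeasure (scale_law b s) A) \<in> borel_measurable borel"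
    by (simp add: scale_law_def emeasure_density)
qed (simp_all add: subprob_space_scale_law assms)

lemma sets_gamma_law [measurable_cong, simp]: "sets (gamma_law a) = sets borel"
  by (simp add: gamma_law_def)

lemma prob_space_gamma_law:
  assumes a: "0 < a"
  shows "prob_space (gamma_law a)"
proof
  have "emeasure (gamma_law a) (space (gamma_law a)) =
      (\<integral>\<^sup>+t. ennreal (if t > 0 then t powr (a - 1) * exp (- t) / Gamma a else 0) \<partial>lborel)"
    by (simp add: gamma_law_def emeasure_density)
  also have "\<dots> = (\<integral>\<^sup>+t. ennreal (1 / Gamma a) * ennreal (indicator {0..} t * t powr (a - 1) / exp t) \<partial>lborel)"
  proof (rule nn_integral_cong_AE)
    show "AE t in lborel. ennreal (if t > 0 then t powr (a - 1) * exp (- t) / Gamma a else 0) =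
        ennreal (1 / Gamma a) * ennreal (indicator {0..} t * t powr (a - 1) / exp t)"
      using AE_lborel_singleton[of 0] 
    proof eventually_elim
      case (elim t)
      show ?case
        using elim Gamma_real_pos[OF a]
        by (auto simp: exp_minus field_simps simp flip: ennreal_mult split: split_indicator)
    qed
  qed
  also have "\<dots> = ennreal (1 / Gamma a) * ennreal (Gamma a)"
    by (subst nn_integral_cmult) (auto simp: Gamma_conv_nn_integral_real[OF a])
  also have "\<dots> = 1"
    using Gamma_real_pos[OF a] by (simp flip: ennreal_mult)
  finally show "emeasure (gamma_law a) (space (gamma_law a)) = 1" .
qed

lemma AE_gamma_law_pos: "AE t in gamma_law a. 0 < t"
  unfolding gamma_law_def by (subst AE_density) (auto split: if_splits)

text \<open>Given k, the product of the \<open>T l\<close> is almost surely positive, so by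
  \<open>nn_integral_scale_law\<close> the inner integral is the same for all T and k, and the Gamma
  laws only contribute mass one. What is left of the network is the total weight c, the product of
  \<open>1 - 1 / 2 ^ n l\<close> over the hidden layers.\<close>

lemma
  fixes d :: nat and n :: "nat \<Rightarrow> nat"
  assumes card: "CARD('p::finite) \<ge> 5" and n: "\<forall>l\<in>{1..d-1}. n l \<ge> 1"
  shows sets_relu_prior: "sets (relu_prior d n :: (real^'p) measure) = sets borel"
    and nn_integral_relu_prior: "\<exists>c>0. \<forall>f\<in>borel_measurable borel. (\<integral>\<^sup>+\<theta>. f \<theta> \<partial>(relu_prior d n :: (real^'p) measure)) =
      ennreal c * (\<integral>\<^sup>+w. (\<integral>\<^sup>+\<theta>. f \<theta> * ennreal (normal_vec_density 0 w \<theta>) \<partial>lborel)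
         * ennreal (beta_prime_1_density (real CARD('p) / 2 - 2) w) \<partial>lborel)"
proof -
  define b where "b = real CARD('p) / 2 - 2"
  have b: "0 < b" using card by (simp add: b_def)
  let ?I = "{1..d-1}"
  define A where "A = (\<Pi>\<^sub>E l\<in>?I. {1..n l})"
  define wt where "wt k = ennreal ((\<Prod>l\<in>?I. real (n l choose k l)) / 2 ^ (\<Sum>l\<in>?I. n l))" for k
  define G where "G k = (\<Pi>\<^sub>M l\<in>?I. gamma_law (real (k l) / 2))" for k :: "nat \<Rightarrow> nat"
  \<comment> \<open>The law of \<theta> given T; the index k enters only through
    \<open>G k\<close>.\<close>
  define K where "K T = scale_law b (\<Prod>l\<in>?I. T l) \<bind> (\<lambda>u. normal_vec (0 :: real^'p) (u * (\<Prod>l\<in>?I. T l)))" for T :: "nat \<Rightarrow> real"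
  have prior: "relu_prior d n = point_measure A wt \<bind> (\<lambda>k. G k \<bind> K)"
    unfolding relu_prior_def active_units_def A_def wt_def[abs_def] G_def K_def b_def Let_def ..
  have A: "finite A" "A \<noteq> {}"
    using n unfolding A_def by (auto intro!: finite_PiE simp: PiE_eq_empty_iff)
  have kpos: "0 < real (k l) / 2" if "k \<in> A" "l \<in> ?I" for k l
  proof -
    have "k l \<in> {1..n l}" using that unfolding A_def by (rule PiE_mem)
    then show ?thesis by simp
  qed
  have pG: "prob_space (G k)" if "k \<in> A" for k
    unfolding G_def using kpos[OF that] by (intro prob_space_PiM prob_space_gamma_law)
  have prod_m[measurable]: "(\<lambda>T. \<Prod>l\<in>?I. T l) \<in> borel_measurable (G k)" for k
  proof -
    have "(\<lambda>T. T l) \<in> borel_measurable (G k)" if "l \<in> ?I" for l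
      using measurable_component_singleton[OF that, of "\<lambda>l. gamma_law (real (k l) / 2)"]
      unfolding G_def by (simp cong: measurable_cong_sets)
    then show ?thesis by (rule borel_measurable_prod)
  qed
  have K1: "(\<lambda>T. scale_law b (\<Prod>l\<in>?I. T l)) \<in> G k \<rightarrow>\<^sub>M subprob_algebra borel" for k
    by (rule measurable_compose[OF prod_m measurable_scale_law[OF b]])
  have K: "K \<in> G k \<rightarrow>\<^sub>M subprob_algebra borel" for k
    unfolding K_def by (rule measurable_bind[OF K1]) measurable
  \<comment> \<open>On a point measure every map is measurable; what needs a check is that each
    value is a subprobability measure on the Borel sets.\<close>
  have GK: "(\<lambda>k. G k \<bind> K) \<in> point_measure A wt \<rightarrow>\<^sub>M subprob_algebra borel"
  proof -
    have "subprob_space (G k \<bind> K)" "sets (G k \<bind> K) = sets borel" if "k \<in> A" for k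
    proof -
      interpret prob_space "G k" by (rule pG[OF that])
      show "subprob_space (G k \<bind> K)"
        by (intro subprob_space_bind[OF _ K]) unfold_locales
      show "sets (G k \<bind> K) = sets borel"
        by (rule sets_bind_measurable[OF K not_empty])
    qed
    then show ?thesis by (auto simp: space_subprob_algebra)
  qed
  have "space (point_measure A wt) \<noteq> {}" using A by (simp add: space_point_measure)
  then show "sets (relu_prior d n :: (real^'p) measure) = sets borel"
    unfolding prior by (intro sets_bind_measurable[OF GK])
  define c where "c = (\<Sum>k\<in>A. (\<Prod>l\<in>?I. real (n l choose k l)) / 2 ^ (\<Sum>l\<in>?I. n l))"
  have c: "0 < c"
    unfolding c_def
  proof (intro sum_pos A divide_pos_pos prod_pos ballI)
    fix k l assume "k \<in> A" "l \<in> ?I"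
    then have "k l \<in> {1..n l}" unfolding A_def by (rule PiE_mem)
    then show "0 < real (n l choose k l)" by simp
  qed simp
  have mass: "emeasure (point_measure A wt) A = ennreal c"
    using A unfolding c_def wt_def
    by (subst emeasure_point_measure_finite) (auto intro!: sum_ennreal divide_nonneg_nonneg prod_nonneg)
  have "(\<integral>\<^sup>+\<theta>. f \<theta> \<partial>(relu_prior d n :: (real^'p) measure)) =
      ennreal c * (\<integral>\<^sup>+w. (\<integral>\<^sup>+\<theta>. f \<theta> * ennreal (normal_vec_density 0 w \<theta>) \<partial>lborel) * ennreal (beta_prime_1_density b w) \<partial>lborel)"
    if f[measurable]: "f \<in> borel_measurable borel" for f :: "real^'p \<Rightarrow> ennreal"
  proof -
    define R where "R w = (\<integral>\<^sup>+\<theta>. f \<theta> \<partial>normal_vec (0::real^'p) w)" for w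
    have R[measurable]: "R \<in> borel_measurable borel"
      unfolding R_def[abs_def] by (rule nn_integral_measurable_subprob_algebra2[of _ _ borel]) measurable
    let ?J = "\<integral>\<^sup>+w. R w * ennreal (beta_prime_1_density b w) \<partial>lborel"
    have KT: "(\<integral>\<^sup>+\<theta>. f \<theta> \<partial>K T) = (if 0 < (\<Prod>l\<in>?I. T l) then ?J else 0)" for T
    proof -
      have "(\<integral>\<^sup>+\<theta>. f \<theta> \<partial>K T) = (\<integral>\<^sup>+u. R (u * (\<Prod>l\<in>?I. T l)) \<partial>scale_law b (\<Prod>l\<in>?I. T l))"
        unfolding K_def R_def by (rule nn_integral_bind[OF f]) measurable
      then show ?thesis using b by (simp add: nn_integral_scale_law)
    qed
    have Gk: "(\<integral>\<^sup>+\<theta>. f \<theta> \<partial>(G k \<bind> K)) = ?J" if k: "k \<in> A" for k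
    proof -
      interpret prob_space "G k" by (rule pG[OF k])
      have "AE T in G k. \<forall>l\<in>?I. 0 < T l"
        unfolding G_def using kpos[OF k]
        by (intro AE_finite_allI AE_PiM_component prob_space_gamma_law AE_gamma_law_pos) auto
      then have "AE T in G k. 0 < (\<Prod>l\<in>?I. T l)"
        by eventually_elim (auto intro: prod_pos)
      then have "AE T in G k. (\<integral>\<^sup>+\<theta>. f \<theta> \<partial>K T) = ?J"
        by eventually_elim (simp add: KT)
      then have "(\<integral>\<^sup>+T. \<integral>\<^sup>+\<theta>. f \<theta> \<partial>K T \<partial>G k) = (\<integral>\<^sup>+T. ?J \<partial>G k)"
        by (rule nn_integral_cong_AE)
      then show ?thesis
        by (simp add: nn_integral_bind[OF f K] emeasure_space_1)
    qed
    have "(\<integral>\<^sup>+\<theta>. f \<theta> \<partial>relu_prior d n) = (\<integral>\<^sup>+k. \<integral>\<^sup>+\<theta>. f \<theta> \<partial>(G k \<bind> K) \<partial>point_measure A wt)"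
      unfolding prior by (rule nn_integral_bind[OF f GK])
    also have "\<dots> = (\<integral>\<^sup>+k. ?J \<partial>point_measure A wt)"
      by (rule nn_integral_cong) (simp add: Gk space_point_measure)
    also have "\<dots> = ennreal c * ?J"
      by (simp add: space_point_measure mass mult.commute)
    finally show ?thesis
      by (simp add: R_def nn_integral_density_normal_vec)
  qed
  then show "\<exists>c>0. \<forall>f\<in>borel_measurable borel. (\<integral>\<^sup>+\<theta>. f \<theta> \<partial>(relu_prior d n :: (real^'p) measure)) =
      ennreal c * (\<integral>\<^sup>+w. (\<integral>\<^sup>+\<theta>. f \<theta> * ennreal (normal_vec_density 0 w \<theta>) \<partial>lborel)
         * ennreal (beta_prime_1_density (real CARD('p) / 2 - 2) w) \<partial>lborel)"
    using c unfolding b_def by blast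
qed

section \<open>The posterior mean\<close>

text \<open>The integrand centred at m is odd under the reflection
  \<open>x \<mapsto> 2 *\<^sub>R m - x\<close>, which preserves Lebesgue measure, so its integral
  equals its own negative.\<close>

lemma first_moment_normal_vec_density:
  fixes m :: "real^'p"
  assumes v: "0 < v"
  shows "integrable lborel (\<lambda>x. normal_vec_density m v x *\<^sub>R x)"
    and "(\<integral>x. normal_vec_density m v x *\<^sub>R x \<partial>lborel) = m"
proof -
  let ?g = "\<lambda>x. normal_vec_density m v x *\<^sub>R (x - m)"
  note N = integrable_normal_vec_density[OF v, of m]
  have g: "integrable lborel ?g"
  proof (rule Bochner_Integration.integrable_bound)
    show "integrable lborel (\<lambda>x. normal_vec_density m v x + (norm (x - m))\<^sup>2 * normal_vec_density m v x)"
      by (intro Bochner_Integration.integrable_add N(1) integrable_normal_vec_density_second_moment v)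
    show "AE x in lborel. norm (?g x) \<le> norm (normal_vec_density m v x + (norm (x - m))\<^sup>2 * normal_vec_density m v x)"
    proof (rule AE_I2)
      fix x
      have "norm (x - m) \<le> 1 + (norm (x - m))\<^sup>2"
        using zero_le_power2[of "norm (x - m) - 1"] norm_ge_zero[of "x - m"]
        unfolding power2_eq_square left_diff_distrib right_diff_distrib by linarith
      then have "norm (x - m) * normal_vec_density m v x \<le> (1 + (norm (x - m))\<^sup>2) * normal_vec_density m v x"
        by (intro mult_right_mono) auto
      then show "norm (?g x) \<le> norm (normal_vec_density m v x + (norm (x - m))\<^sup>2 * normal_vec_density m v x)"
        by (simp add: distrib_left distrib_right mult.commute)
    qed
  qed simp
  have "normal_vec_density m v (2 *\<^sub>R m - x) = normal_vec_density m v x" for x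
  proof -
    have "2 *\<^sub>R m - x - m = m - x" by (simp add: scaleR_2)
    then show ?thesis using v by (simp add: normal_vec_density_eq norm_minus_commute)
  qed
  moreover have "(\<integral>x. ?g x \<partial>lborel) = (\<integral>x. ?g (2 *\<^sub>R m - x) \<partial>lborel)"
  proof -
    have "distr lborel borel (\<lambda>x::real^'p. 2 *\<^sub>R m - x) = lborel"
      using lborel_affine[of "-1" "2 *\<^sub>R m"] by (simp add: density_1)
    then have "(\<integral>x. ?g x \<partial>lborel) = (\<integral>x. ?g x \<partial>distr lborel borel (\<lambda>x. 2 *\<^sub>R m - x))"
      by (simp only:)
    also have "\<dots> = (\<integral>x. ?g (2 *\<^sub>R m - x) \<partial>lborel)"
      by (rule integral_distr) measurable
    finally show ?thesis .
  qed
  ultimately have "(\<integral>x. ?g x \<partial>lborel) = (\<integral>x. - ?g x \<partial>lborel)"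
    by (simp add: scaleR_2 algebra_simps)
  then have g0: "(\<integral>x. ?g x \<partial>lborel) = 0"
    by (simp add: eq_neg_iff_add_eq_0 flip: scaleR_2)
  have eq: "normal_vec_density m v x *\<^sub>R x = ?g x + normal_vec_density m v x *\<^sub>R m" for x
    by (simp add: algebra_simps)
  show "integrable lborel (\<lambda>x. normal_vec_density m v x *\<^sub>R x)"
    unfolding eq using g N by simp
  show "(\<integral>x. normal_vec_density m v x *\<^sub>R x \<partial>lborel) = m"
    unfolding eq using g N g0 by simp
qed

text \<open>\<open>N(0, 1 + w)\<close> is the law of the observation given w. The powers of
  \<open>1 + w\<close> add up to \<open>- (b + 1) - p/2 = - (p - 1)\<close>, which yields the
  integrand of \<open>laplace_int (p - 1)\<close> at \<open>(norm y)^2 / 2\<close>.\<close>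

lemma beta_prime_marginal:
  assumes "0 < w"
  defines "b \<equiv> real CARD('p::finite) / 2 - 2"
  shows "beta_prime_1_density b w * normal_vec_density 0 (1 + w) (y :: real^'p)
    = b / sqrt (2 * pi) ^ CARD('p) * ((1 / (1 + w)) ^ (CARD('p) - 1) * exp (- ((norm y)\<^sup>2 / 2 / (1 + w))))"
proof -
  let ?p = "CARD('p)"
  have "sqrt (2 * pi * (1 + w)) ^ ?p = sqrt (2 * pi) ^ ?p * (1 + w) powr (real ?p / 2)"
    using assms by (simp add: real_sqrt_mult power_mult_distrib powr_half_sqrt[symmetric, of "1 + w"] powr_power)
  moreover have "(1 + w) powr (- (b + 1)) / (1 + w) powr (real ?p / 2) = (1 / (1 + w)) ^ (?p - 1)"
  proof -
    have "(1 + w) powr (- (b + 1)) / (1 + w) powr (real ?p / 2) = (1 + w) powr (- real (?p - 1))"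
    proof -
      have "- (b + 1) - real ?p / 2 = - real (?p - 1)"
        by (simp add: b_def of_nat_diff Suc_le_eq field_simps)
      then show ?thesis by (simp only: powr_diff[symmetric])
    qed
    also have "\<dots> = (1 / (1 + w)) ^ (?p - 1)"
    proof -
      have "(1 + w) powr (- real k) = (1 / (1 + w)) ^ k" for k
        using assms by (simp add: powr_minus powr_realpow power_one_over inverse_eq_divide)
      then show ?thesis .
    qed
    finally show ?thesis .
  qed
  ultimately show ?thesis
    using assms by (simp add: beta_prime_1_density_def normal_vec_density_eq field_simps)
qed

text \<open>Given w and y, conjugacy makes \<theta> normal with mean
  \<open>(w / (1 + w)) *\<^sub>R y\<close>. Averaging \<open>w / (1 + w) = 1 - 1 / (1 + w)\<close>
  over the posterior of w gives one minus the shrinkage factor.\<close>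

lemma posterior_mean_relu_prior:
  fixes d :: nat and n :: "nat \<Rightarrow> nat" and y :: "real^'p"
  assumes card: "CARD('p::finite) \<ge> 5" and n: "\<forall>l\<in>{1..d-1}. n l \<ge> 1"
  shows "posterior_mean (relu_prior d n :: (real^'p) measure) y =
    y - shrink_factor CARD('p) ((norm y)\<^sup>2) *\<^sub>R y"
proof -
  let ?p = "CARD('p)"
  let ?\<pi> = "relu_prior d n :: (real^'p) measure"
  define b where "b = real ?p / 2 - 2"
  have b: "0 < b" using card by (simp add: b_def)
  let ?h = "beta_prime_1_density b"
  have h0: "0 \<le> ?h w" for w using b by (simp add: beta_prime_1_density_nonneg)
  note [measurable_cong] = sets_relu_prior[OF card n]
  obtain c where c: "0 < c" and \<pi>: "\<And>f. f \<in> borel_measurable borel \<Longrightarrow> (\<integral>\<^sup>+\<theta>. f \<theta> \<partial>?\<pi>) =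
      ennreal c * (\<integral>\<^sup>+w. (\<integral>\<^sup>+\<theta>. f \<theta> * ennreal (normal_vec_density 0 w \<theta>) \<partial>lborel) * ennreal (?h w) \<partial>lborel)"
    using nn_integral_relu_prior[OF card n] unfolding b_def by blast
  define s where "s = (norm y)\<^sup>2 / 2"
  define I where "I = laplace_int (?p - 1) s"
  have I: "0 < I" unfolding I_def using card by (intro laplace_int_pos) simp
  define \<kappa> where "\<kappa> = b / sqrt (2 * pi) ^ ?p"
  have \<kappa>: "0 < \<kappa>" using b by (simp add: \<kappa>_def)
  \<comment> \<open>The posterior density of w; \<open>\<kappa> * I\<close> is the marginal density
    of y under the normalized mixture.\<close>
  define g where "g w = ?h w * normal_vec_density 0 (1 + w) y / (\<kappa> * I)" for w
  have gm[measurable]: "g \<in> borel_measurable borel" unfolding g_def[abs_def] by measurable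
  have g0: "0 \<le> g w" for w using h0 \<kappa> I by (simp add: g_def)
  have gneg: "g w = 0" if "w \<le> 0" for w using that by (simp add: g_def beta_prime_1_density_def)
  have gpos: "g w = (1 / (1 + w)) ^ (?p - 1) * exp (- (s / (1 + w))) / I" if "0 < w" for w
    using beta_prime_marginal[OF that, of y] \<kappa> unfolding g_def b_def[symmetric] \<kappa>_def[symmetric] s_def by simp
  have gAE: "AE w in lborel. g w = (indicator {0..} w * ((1 / (1 + w)) ^ (?p - 1) * exp (- (s / (1 + w))))) / I"
    using AE_lborel_singleton[of 0]
  proof eventually_elim
    case (elim w)
    then show ?case by (cases "0 < w") (simp_all add: gpos gneg)
  qed
  have gint: "integrable lborel g" and gval: "(\<integral>w. g w \<partial>lborel) = 1"
  proof -
    have i: "integrable lborel (\<lambda>w. indicator {0..} w * ((1 / (1 + w)) ^ (?p - 1) * exp (- (s / (1 + w)))) / I)"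
      using card by (intro integrable_divide integrable_laplace_int) simp
    show "integrable lborel g"
      by (subst integrable_cong_AE[OF _ _ gAE]) (use i in auto)
    show "(\<integral>w. g w \<partial>lborel) = 1"
      by (subst integral_cong_AE[OF _ _ gAE]) (use I in \<open>auto simp: I_def laplace_int_def\<close>)
  qed
  \<comment> \<open>The joint posterior density of w and \<theta>, curried as \<open>J\<close> and
    uncurried as \<open>j\<close>. The posterior of \<theta> is treated as a marginal of it because
    fact \<open>\<pi>\<close> only gives nonnegative integrals, while the posterior mean is a
    vector-valued one.\<close>
  define J where "J w \<theta> = ?h w * normal_vec_density 0 w \<theta> * normal_vec_density \<theta> 1 y / (\<kappa> * I)" for w \<theta>
  define j where "j z = J (fst z) (snd z)" for z
  have jm[measurable]: "j \<in> borel_measurable (borel \<Otimes>\<^sub>M borel)"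
    unfolding j_def[abs_def] J_def by measurable
  have j0: "0 \<le> j z" for z using h0 \<kappa> I by (simp add: j_def J_def)
  have J0: "0 \<le> J w \<theta>" for w \<theta> using h0 \<kappa> I by (simp add: J_def)
  \<comment> \<open>Conjugacy; for \<open>w \<le> 0\<close> both sides vanish with the hyperprior
    density.\<close>
  have Jg: "J w \<theta> = g w * normal_vec_density ((w / (1 + w)) *\<^sub>R y) (w / (1 + w)) \<theta>" for w \<theta>
  proof (cases "0 < w")
    case True
    from normal_vec_density_mult[OF this, of \<theta> y] show ?thesis by (simp add: J_def g_def mult.assoc)
  qed (simp add: J_def g_def beta_prime_1_density_def)
  have marg: "(\<integral>\<^sup>+\<theta>. ennreal (normal_vec_density \<theta> 1 y) \<partial>?\<pi>) = ennreal (c * (\<kappa> * I))"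
  proof -
    have "(\<integral>\<^sup>+\<theta>. ennreal (normal_vec_density \<theta> 1 y) * ennreal (normal_vec_density 0 w \<theta>) \<partial>lborel) * ennreal (?h w)
        = ennreal (\<kappa> * I * g w)" for w
    proof (cases "0 < w")
      case True
      have "(\<integral>\<^sup>+\<theta>. ennreal (normal_vec_density \<theta> 1 y) * ennreal (normal_vec_density 0 w \<theta>) \<partial>lborel)
          = (\<integral>\<^sup>+\<theta>. ennreal (normal_vec_density 0 (1 + w) y) * ennreal (normal_vec_density ((w / (1 + w)) *\<^sub>R y) (w / (1 + w)) \<theta>) \<partial>lborel)"
        using normal_vec_density_mult[OF True, of _ y]
        by (intro nn_integral_cong) (simp add: mult.commute flip: ennreal_mult)
      also have "\<dots> = ennreal (normal_vec_density 0 (1 + w) y)"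
        using True by (simp add: nn_integral_cmult nn_integral_normal_vec_density)
      finally show ?thesis
        using \<kappa> I h0 by (simp add: g_def mult.commute flip: ennreal_mult)
    qed (simp add: g_def beta_prime_1_density_def)
    then have "(\<integral>\<^sup>+\<theta>. ennreal (normal_vec_density \<theta> 1 y) \<partial>?\<pi>) = ennreal c * (\<integral>\<^sup>+w. ennreal (\<kappa> * I * g w) \<partial>lborel)"
      by (subst \<pi>) simp_all
    also have "(\<integral>\<^sup>+w. ennreal (\<kappa> * I * g w) \<partial>lborel) = ennreal (\<kappa> * I)"
      using gint gval g0 \<kappa> I by (subst nn_integral_eq_integral) auto
    finally show ?thesis using c \<kappa> I by (simp flip: ennreal_mult)
  qed
  have Pm: "posterior ?\<pi> y = distr (density (lborel \<Otimes>\<^sub>M lborel) (\<lambda>z. ennreal (j z))) borel snd"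
  proof (rule measure_eqI)
    show "sets (posterior ?\<pi> y) = sets (distr (density (lborel \<Otimes>\<^sub>M lborel) (\<lambda>z. ennreal (j z))) borel snd)"
      by (simp add: posterior_def sets_relu_prior[OF card n])
    fix X assume "X \<in> sets (posterior ?\<pi> y)"
    then have X[measurable]: "X \<in> sets borel" by (simp add: posterior_def sets_relu_prior[OF card n])
    \<comment> \<open>The mass c of the prior cancels against the one in the marginal
      density.\<close>
    have J1: "ennreal c * (ennreal (normal_vec_density \<theta> 1 y) / ennreal (c * (\<kappa> * I)) * i * ennreal (normal_vec_density 0 w \<theta>) * ennreal (?h w))
        = ennreal (J w \<theta>) * i" for w \<theta> i
    proof -
      have "ennreal (normal_vec_density \<theta> 1 y) / ennreal (c * (\<kappa> * I)) = ennreal (normal_vec_density \<theta> 1 y / (c * (\<kappa> * I)))"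
        using c \<kappa> I by (intro divide_ennreal) auto
      moreover have "ennreal c * (ennreal a * i * ennreal u * ennreal v) = ennreal (c * a * u * v) * i"
        if "0 \<le> a" "0 \<le> u" "0 \<le> v" for a u v
        using c that by (simp add: ennreal_mult mult_ac)
      ultimately have "ennreal c * (ennreal (normal_vec_density \<theta> 1 y) / ennreal (c * (\<kappa> * I)) * i * ennreal (normal_vec_density 0 w \<theta>) * ennreal (?h w))
        = ennreal (c * (normal_vec_density \<theta> 1 y / (c * (\<kappa> * I))) * normal_vec_density 0 w \<theta> * ?h w) * i"
        using c \<kappa> I h0 by (simp only:) simp
      also have "c * (normal_vec_density \<theta> 1 y / (c * (\<kappa> * I))) * normal_vec_density 0 w \<theta> * ?h w = J w \<theta>"
        using c by (simp add: J_def)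
      finally show ?thesis .
    qed
    have "emeasure (posterior ?\<pi> y) X = (\<integral>\<^sup>+\<theta>. ennreal (normal_vec_density \<theta> 1 y) / ennreal (c * (\<kappa> * I)) * indicator X \<theta> \<partial>?\<pi>)"
      unfolding posterior_def marg by (rule emeasure_density) measurable
    also have "\<dots> = ennreal c * (\<integral>\<^sup>+w. (\<integral>\<^sup>+\<theta>. ennreal (normal_vec_density \<theta> 1 y) / ennreal (c * (\<kappa> * I)) * indicator X \<theta>
        * ennreal (normal_vec_density 0 w \<theta>) \<partial>lborel) * ennreal (?h w) \<partial>lborel)"
      by (rule \<pi>) measurable
    also have "\<dots> = (\<integral>\<^sup>+w. \<integral>\<^sup>+\<theta>. ennreal (J w \<theta>) * indicator X \<theta> \<partial>lborel \<partial>lborel)"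
      by (simp add: J1 flip: nn_integral_cmult nn_integral_multc)
    also have "\<dots> = (\<integral>\<^sup>+z. ennreal (j z) * indicator X (snd z) \<partial>(lborel \<Otimes>\<^sub>M lborel))"
      by (subst lborel.nn_integral_fst[symmetric]) (measurable, simp add: j_def)
    also have "\<dots> = (\<integral>\<^sup>+z. indicator X (snd z) \<partial>density (lborel \<Otimes>\<^sub>M lborel) (\<lambda>z. ennreal (j z)))"
      by (rule nn_integral_density[symmetric]) measurable
    also have "\<dots> = (\<integral>\<^sup>+\<theta>. indicator X \<theta> \<partial>distr (density (lborel \<Otimes>\<^sub>M lborel) (\<lambda>z. ennreal (j z))) borel snd)"
      by (rule nn_integral_distr[symmetric]) measurable
    also have "\<dots> = emeasure (distr (density (lborel \<Otimes>\<^sub>M lborel) (\<lambda>z. ennreal (j z))) borel snd) X"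
      by simp
    finally show "emeasure (posterior ?\<pi> y) X = emeasure (distr (density (lborel \<Otimes>\<^sub>M lborel) (\<lambda>z. ennreal (j z))) borel snd) X" .
  qed
  \<comment> \<open>Given w and y, the second moment of \<theta> is at most
    \<open>p + (norm y)^2\<close>, uniformly in w because \<open>w / (1 + w) \<le> 1\<close>; this
    replaces moments of the prior.\<close>
  have int: "integrable (lborel \<Otimes>\<^sub>M lborel) (\<lambda>z. j z *\<^sub>R snd z)"
  proof (rule integrableI_bounded)
    have "(\<integral>\<^sup>+z. ennreal (norm (j z *\<^sub>R snd z)) \<partial>(lborel \<Otimes>\<^sub>M lborel))
        = (\<integral>\<^sup>+w. \<integral>\<^sup>+\<theta>. ennreal (J w \<theta> * norm \<theta>) \<partial>lborel \<partial>lborel)"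
      by (subst lborel.nn_integral_fst[symmetric]) (measurable, simp add: j_def J0)
    also have "\<dots> \<le> (\<integral>\<^sup>+w. ennreal ((1 + real ?p + (norm y)\<^sup>2) * g w) \<partial>lborel)"
    proof (rule nn_integral_mono)
      fix w :: real
      let ?m = "(w / (1 + w)) *\<^sub>R y" and ?v = "w / (1 + w)"
      show "(\<integral>\<^sup>+\<theta>. ennreal (J w \<theta> * norm \<theta>) \<partial>lborel) \<le> ennreal ((1 + real ?p + (norm y)\<^sup>2) * g w)"
      proof (cases "0 < w")
        case True
        then have v: "0 < ?v" "?v \<le> 1" by auto
        have "(\<integral>\<^sup>+\<theta>. ennreal (J w \<theta> * norm \<theta>) \<partial>lborel) \<le>
            (\<integral>\<^sup>+\<theta>. ennreal (g w) * (ennreal (normal_vec_density ?m ?v \<theta>) + ennreal ((norm (\<theta> - 0))\<^sup>2) * ennreal (normal_vec_density ?m ?v \<theta>)) \<partial>lborel)"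
        proof (rule nn_integral_mono)
          fix \<theta> :: "real^'p"
          have "norm \<theta> \<le> 1 + (norm \<theta>)\<^sup>2"
            using zero_le_power2[of "norm \<theta> - 1"] norm_ge_zero[of \<theta>]
            unfolding power2_eq_square left_diff_distrib right_diff_distrib by linarith
          then have "J w \<theta> * norm \<theta> \<le> J w \<theta> * (1 + (norm \<theta>)\<^sup>2)"
            using J0 by (intro mult_left_mono) auto
          then have "ennreal (J w \<theta> * norm \<theta>) \<le> ennreal (g w * (normal_vec_density ?m ?v \<theta> + (norm (\<theta> - 0))\<^sup>2 * normal_vec_density ?m ?v \<theta>))"
            by (intro ennreal_leI) (simp add: Jg algebra_simps)
          also have "\<dots> = ennreal (g w) * (ennreal (normal_vec_density ?m ?v \<theta>) + ennreal ((norm (\<theta> - 0))\<^sup>2) * ennreal (normal_vec_density ?m ?v \<theta>))"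
            using g0 by (simp add: ennreal_mult)
          finally show "ennreal (J w \<theta> * norm \<theta>) \<le> ennreal (g w) * (ennreal (normal_vec_density ?m ?v \<theta>) + ennreal ((norm (\<theta> - 0))\<^sup>2) * ennreal (normal_vec_density ?m ?v \<theta>))" .
        qed
        also have "\<dots> = ennreal (g w) * (\<integral>\<^sup>+\<theta>. ennreal (normal_vec_density ?m ?v \<theta>) + ennreal ((norm (\<theta> - 0))\<^sup>2) * ennreal (normal_vec_density ?m ?v \<theta>) \<partial>lborel)"
          by (rule nn_integral_cmult) measurable
        also have "(\<integral>\<^sup>+\<theta>. ennreal (normal_vec_density ?m ?v \<theta>) + ennreal ((norm (\<theta> - 0))\<^sup>2) * ennreal (normal_vec_density ?m ?v \<theta>) \<partial>lborel)
            = 1 + ennreal (real ?p * ?v + (norm (?m - 0))\<^sup>2)"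
        proof -
          have "(\<integral>\<^sup>+\<theta>. ennreal (normal_vec_density ?m ?v \<theta>) + ennreal ((norm (\<theta> - 0))\<^sup>2) * ennreal (normal_vec_density ?m ?v \<theta>) \<partial>lborel)
              = (\<integral>\<^sup>+\<theta>. ennreal (normal_vec_density ?m ?v \<theta>) \<partial>lborel)
                + (\<integral>\<^sup>+\<theta>. ennreal ((norm (\<theta> - 0))\<^sup>2) * ennreal (normal_vec_density ?m ?v \<theta>) \<partial>lborel)"
            by (rule nn_integral_add) measurable
          also have "\<dots> = 1 + ennreal (real ?p * ?v + (norm (?m - 0))\<^sup>2)"
            by (simp only: nn_integral_normal_vec_density[OF v(1)] nn_integral_normal_vec_density_second_moment[OF v(1)])
          finally show ?thesis .
        qed
        also have "ennreal (g w) * (1 + ennreal (real ?p * ?v + (norm (?m - 0))\<^sup>2)) = ennreal (g w * (1 + (real ?p * ?v + (norm ?m)\<^sup>2)))"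
        proof -
          have e: "ennreal (g w) * (1 + ennreal a) = ennreal (g w * (1 + a))" if "0 \<le> a" for a
            using g0 that by (simp add: ennreal_mult)
          show ?thesis
            unfolding diff_zero by (rule e)
              (intro add_nonneg_nonneg mult_nonneg_nonneg zero_le_power2 of_nat_0_le_iff less_imp_le[OF v(1)])
        qed
        also have "\<dots> \<le> ennreal ((1 + real ?p + (norm y)\<^sup>2) * g w)"
        proof (rule ennreal_leI)
          have "norm ?m \<le> norm y"
            using mult_left_le_one_le[OF norm_ge_zero[of y], of ?v] v True unfolding norm_scaleR by simp
          then have q1: "(norm ?m)\<^sup>2 \<le> (norm y)\<^sup>2" by (intro power_mono) auto
          have q2: "real ?p * ?v \<le> real ?p" using v by (intro mult_left_le) auto
          have "g w * (1 + (real ?p * ?v + (norm ?m)\<^sup>2)) \<le> g w * (1 + real ?p + (norm y)\<^sup>2)"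
            unfolding add.assoc by (intro mult_left_mono add_mono order_refl q1 q2 g0)
          then show "g w * (1 + (real ?p * ?v + (norm ?m)\<^sup>2)) \<le> (1 + real ?p + (norm y)\<^sup>2) * g w"
            by (simp add: mult.commute)
        qed
        finally show ?thesis .
      qed (simp add: Jg gneg)
    qed
    also have "\<dots> < \<infinity>"
      using gint g0 by (subst nn_integral_eq_integral) auto
    finally show "(\<integral>\<^sup>+z. ennreal (norm (j z *\<^sub>R snd z)) \<partial>(lborel \<Otimes>\<^sub>M lborel)) < \<infinity>" .
  qed simp
  have "posterior_mean ?\<pi> y = (\<integral>z. snd z \<partial>density (lborel \<Otimes>\<^sub>M lborel) (\<lambda>z. ennreal (j z)))"
    unfolding posterior_mean_def Pm by (subst integral_distr) simp_all
  also have "\<dots> = (\<integral>z. j z *\<^sub>R snd z \<partial>(lborel \<Otimes>\<^sub>M lborel))"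
    using j0 by (intro integral_density) auto
  also have "\<dots> = (\<integral>w. \<integral>\<theta>. J w \<theta> *\<^sub>R \<theta> \<partial>lborel \<partial>lborel)"
    using lborel_pair.integral_fst'[OF int] by (simp add: j_def)
  \<comment> \<open>The first summand integrates to the mass one of \<open>g\<close>; in the second,
    the extra factor \<open>1 / (1 + w)\<close> raises the exponent in \<open>laplace_int\<close>
    from \<open>p - 1\<close> to p.\<close>
  also have "\<dots> = (\<integral>w. (g w - g w / (1 + w)) *\<^sub>R y \<partial>lborel)"
  proof (rule Bochner_Integration.integral_cong[OF refl])
    fix w :: real
    show "(\<integral>\<theta>. J w \<theta> *\<^sub>R \<theta> \<partial>lborel) = (g w - g w / (1 + w)) *\<^sub>R y"
    proof (cases "0 < w")
      case True
      then have "(\<integral>\<theta>. J w \<theta> *\<^sub>R \<theta> \<partial>lborel) = g w *\<^sub>R ((w / (1 + w)) *\<^sub>R y)"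
        by (simp add: Jg first_moment_normal_vec_density flip: scaleR_scaleR)
      then show ?thesis using True by (simp add: field_simps)
    qed (simp add: Jg gneg)
  qed
  also have "\<dots> = (1 - laplace_int ?p s / I) *\<^sub>R y"
  proof -
    have AE: "AE w in lborel. g w / (1 + w) = (indicator {0..} w * ((1 / (1 + w)) ^ ?p * exp (- (s / (1 + w))))) / I"
      using gAE
    proof eventually_elim
      case (elim w)
      have "(1 / (1 + w)) ^ ?p = (1 / (1 + w)) ^ (?p - 1) * (1 / (1 + w))"
        by (metis One_nat_def Suc_pred mult.commute power_Suc zero_less_card_finite)
      then show ?case unfolding elim by simp
    qed
    have i: "integrable lborel (\<lambda>w. indicator {0..} w * ((1 / (1 + w)) ^ ?p * exp (- (s / (1 + w)))) / I)"
      using card by (intro integrable_divide integrable_laplace_int) simp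
    have i2: "integrable lborel (\<lambda>w. g w / (1 + w))"
      by (subst integrable_cong_AE[OF _ _ AE]) (use i in auto)
    have "(\<integral>w. g w / (1 + w) \<partial>lborel) = laplace_int ?p s / I"
      by (subst integral_cong_AE[OF _ _ AE]) (auto simp: laplace_int_def)
    then show ?thesis using gint i2 gval by simp
  qed
  finally show ?thesis by (simp add: s_def I_def shrink_factor_def algebra_simps)
qed

section \<open>Minimaxity\<close>

theorem theorem3p1:
  fixes d :: nat and n :: "nat \<Rightarrow> nat"
  assumes "CARD('p::finite) \<ge> 5"
    and "d \<ge> 2"
    and "\<forall>l\<in>{1..d-1}. n l \<ge> 1"
  shows "minimax (posterior_mean (relu_prior d n :: (real ^ 'p) measure))"
proof -
  let ?\<delta> = "posterior_mean (relu_prior d n :: (real ^ 'p) measure)"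
  have p: "3 \<le> CARD('p)" using assms(1) by simp
  have \<delta>: "?\<delta> = (\<lambda>y. y - shrink_factor CARD('p) ((norm y)\<^sup>2) *\<^sub>R y)"
    using posterior_mean_relu_prior[OF assms(1,3)] by (simp add: fun_eq_iff)
  have "continuous_on UNIV (shrink_factor CARD('p))"
    using shrink_factor(1)[OF p] by (intro continuous_at_imp_continuous_on ballI DERIV_isCont)
  then have [measurable]: "shrink_factor CARD('p) \<in> borel_measurable borel"
    by (rule borel_measurable_continuous_onI)
  \<comment> \<open>Measurability is read off from the closed form; it makes the rule a competitor
    in the infimum.\<close>
  have \<delta>m: "?\<delta> \<in> borel_measurable borel" unfolding \<delta> by measurable
  have 1: "(SUP \<theta>. risk \<theta> ?\<delta>) \<le> ennreal (real CARD('p))"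
    unfolding \<delta> by (intro SUP_least risk_shrinkage_le[OF shrink_factor[OF p]])
  have 2: "ennreal (real CARD('p)) \<le> (INF \<delta>' \<in> (borel_measurable borel :: (real ^ 'p \<Rightarrow> real ^ 'p) set). SUP \<theta>. risk \<theta> \<delta>')"
    by (intro INF_greatest minimax_risk_ge)
  have 3: "(INF \<delta>' \<in> (borel_measurable borel :: (real ^ 'p \<Rightarrow> real ^ 'p) set). SUP \<theta>. risk \<theta> \<delta>') \<le> (SUP \<theta>. risk \<theta> ?\<delta>)"
    by (rule INF_lower[OF \<delta>m])
  show ?thesis
    unfolding minimax_def by (intro conjI \<delta>m antisym order_trans[OF 1 2] 3)
qed

end
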